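(* Let $\mathcal{F}$ be a finite subcollection of $\mathcal{M}(\mathbb{D})$ and suppose $\gamma_f<1$ for each $f\in\mathcal{F}$. If the tangency graph $T(\mathcal{F})$ contains a cycle, then $$\dim \Lambda(\mathcal{F})=\frac{\log\rho(\mathcal{F})}{\log|\mathcal{F}|},$$ and otherwise $\dim\Lambda(\mathcal{F})=0$.
   Context: $\mathbb{D}$ is the open unit disc; $\mathcal{M}(\mathbb{D})$ is the set of Möbius transformations $f$ with $f(\mathbb{D})\subset\mathbb{D}$, $f(\mathbb{D})\neq\mathbb{D}$. For $f\in\mathcal{M}(\mathbb{D})$: if $f(\mathbb{D})$ is internally tangent to $\mathbb{D}$ (at a unique point), $\alpha_f,\beta_f\in\partial\mathbb{D}$ are the unique points with $f(\alpha_f)=\beta_f$; otherwise $\alpha_f=0$, $\beta_f=\infty$. Set $\gamma_f=1/|f'(\alpha_f)|$. The tangency graph $T(\mathcal{F})$ is the directed graph with vertex set $\mathcal{F}$ and a directed edge from $f$ to $g$ iff $\alpha_f=\beta_g$. A cycle is a sequence of vertices $x_0,\dots,x_n$ ($n\ge1$) with $x_0=x_n$ and a directed edge from $x_{i-1}$ to $x_i$ for each $i$. $\rho(\mathcal{F})$ is the spectral radius of the adjacency matrix of $T(\mathcal{F})$. $\Omega(\mathcal{F})$ is the set of all sequences $(f_n)_{n\ge1}$ with $f_n\in\mathcal{F}$, with metric $d((f_n),(g_n))=|\mathcal{F}|^{-k}$ where $k=\min\{i: f_i\neq g_i\}$ (and $d=0$ if the sequences are equal). $\Lambda(\mathcal{F})\subset\Omega(\mathcal{F})$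 is the set of sequences $(f_n)$ for which the composition sequence $F_n=f_1\cdots f_n$ is of limit-disc type, i.e. $\bigcap_n F_n(\overline{\mathbb{D}})$ is a closed disc of positive radius rather than a point. $\dim$ denotes Hausdorff dimension with respect to $d$. *)

theory Defs
  imports "HOL-Analysis.Analysis" "Jordan_Normal_Form.Spectral_Radius"
begin

type_synonym cfun = "complex \<Rightarrow> complex"

text \<open>A Moebius transformation z \<mapsto> (a z + b)/(c z + d), a d - b c \<noteq> 0, represented by its
  canonical total function on the complex plane (value 0 at the pole, by the convention x/0 = 0).
  Distinct Moebius maps give distinct functions, so finite collections are counted correctly.\<close>
definition moebius :: "cfun \<Rightarrow> bool" where
  "moebius f \<longleftrightarrow> (\<exists>a b c d. a * d - b * c \<noteq> 0 \<and> f = (\<lambda>z. (a * z + b) / (c * z + d)))"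

definition unit_disc :: "complex set" where "unit_disc = ball 0 1"

definition MD :: "cfun set" where
  "MD = {f. moebius f \<and> f ` unit_disc \<subseteq> unit_disc \<and> f ` unit_disc \<noteq> unit_disc}"

definition tangent :: "cfun \<Rightarrow> bool" where
  "tangent f \<longleftrightarrow> (\<exists>!p. p \<in> sphere 0 1 \<and> p \<in> closure (f ` unit_disc))"

text \<open>Points of the extended plane as complex option, None = \<infinity>.\<close>
definition beta :: "cfun \<Rightarrow> complex option" where
  "beta f = (if tangent f then Some (THE p. p \<in> sphere 0 1 \<and> p \<in> closure (f ` unit_disc)) else None)"

definition alpha :: "cfun \<Rightarrow> complex option" where
  "alpha f = (if tangent f then Some (THE a. a \<in> sphere 0 1 \<and> Some (f a) = beta f) else Some 0)"

definition gamma :: "cfun \<Rightarrow> real" where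
  "gamma f = 1 / cmod (deriv f (the (alpha f)))"

definition tedge :: "cfun \<Rightarrow> cfun \<Rightarrow> bool" where
  "tedge f g \<longleftrightarrow> alpha f = beta g"

definition has_cycle :: "cfun set \<Rightarrow> bool" where
  "has_cycle F \<longleftrightarrow> (\<exists>n::nat. \<exists>x::nat \<Rightarrow> cfun. n \<ge> 1 \<and> (\<forall>i\<le>n. x i \<in> F) \<and> x 0 = x n \<and>
      (\<forall>i<n. tedge (x i) (x (Suc i))))"

text \<open>An enumeration of the finite set F (spectral radius does not depend on the choice).\<close>
definition enum_of :: "cfun set \<Rightarrow> cfun list" where
  "enum_of F = (SOME xs. distinct xs \<and> set xs = F)"

definition adj_mat :: "cfun set \<Rightarrow> complex mat" where
  "adj_mat F = (let xs = enum_of F in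
     mat (length xs) (length xs) (\<lambda>(i, j). if tedge (xs ! i) (xs ! j) then 1 else 0))"

definition rho :: "cfun set \<Rightarrow> real" where
  "rho F = spectral_radius (adj_mat F)"

text \<open>Omega(F): sequences (f_n)_{n\<ge>1}, stored 0-based: s 0 = f_1.\<close>
definition Omega :: "cfun set \<Rightarrow> (nat \<Rightarrow> cfun) set" where
  "Omega F = {s. \<forall>n. s n \<in> F}"

text \<open>d(s,t) = |F|^(-k), k = least 1-based index where they differ.\<close>
definition seq_dist :: "cfun set \<Rightarrow> (nat \<Rightarrow> cfun) \<Rightarrow> (nat \<Rightarrow> cfun) \<Rightarrow> real" where
  "seq_dist F s t = (if s = t then 0 else 1 / real (card F) ^ Suc (LEAST i. s i \<noteq> t i))"

definition comp_seq :: "(nat \<Rightarrow> cfun) \<Rightarrow> nat \<Rightarrow> cfun" where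
  "comp_seq s n = foldr (\<circ>) (map s [0..<n]) id"

definition limit_disc_type :: "(nat \<Rightarrow> cfun) \<Rightarrow> bool" where
  "limit_disc_type s \<longleftrightarrow>
     (\<exists>c r. r > 0 \<and> (\<Inter>n\<in>{1..}. comp_seq s n ` cball 0 1) = cball c r)"

definition Lambda :: "cfun set \<Rightarrow> (nat \<Rightarrow> cfun) set" where
  "Lambda F = {s \<in> Omega F. limit_disc_type s}"

definition mdiam :: "('a \<Rightarrow> 'a \<Rightarrow> real) \<Rightarrow> 'a set \<Rightarrow> real" where
  "mdiam d U = (if U = {} then 0 else Sup {d x y | x y. x \<in> U \<and> y \<in> U})"

definition hausdorff_delta :: "('a \<Rightarrow> 'a \<Rightarrow> real) \<Rightarrow> real \<Rightarrow> real \<Rightarrow> 'a set \<Rightarrow> ennreal" where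
  "hausdorff_delta d s \<delta> S =
     (INF U \<in> {U :: nat \<Rightarrow> 'a set. S \<subseteq> (\<Union>i. U i) \<and> (\<forall>i. \<forall>x\<in>U i. \<forall>y\<in>U i. d x y \<le> \<delta>)}.
        (\<Sum>i. ennreal (mdiam d (U i) powr s)))"

definition hausdorff_measure :: "('a \<Rightarrow> 'a \<Rightarrow> real) \<Rightarrow> real \<Rightarrow> 'a set \<Rightarrow> ennreal" where
  "hausdorff_measure d s S = (SUP \<delta> \<in> {0<..}. hausdorff_delta d s \<delta> S)"

text \<open>dim S = inf {s \<ge> 0. H^s(S) = 0}; restricting to s > 0 gives the same value
  (and avoids the convention 0 powr 0 = 0).\<close>
definition hausdorff_dim :: "('a \<Rightarrow> 'a \<Rightarrow> real) \<Rightarrow> 'a set \<Rightarrow> ereal" where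
  "hausdorff_dim d S = Inf {ereal s | s. s > 0 \<and> hausdorff_measure d s S = 0}"

end

theory Submission
  imports Defs
begin

text \<open>
  A map with \<open>\<gamma> < 1\<close> is tangent, by the Schwarz-Pick bound at \<open>0\<close>. If \<open>f\<close> does not
  point to \<open>g\<close>, then \<open>f \<circ> g\<close> sends the closed disc into a disc of radius \<open>r < 1\<close> about \<open>0\<close>, and a
  Moebius image of that smaller disc has at most \<open>r\<close> times the radius of the image of the unit disc;
  so infinitely many non-edges force the radii of \<open>F\<^sub>n\<close> to \<open>0\<close>. Along edges, the coordinate
  \<open>(p + z) / (p - z)\<close> at the tangency points turns \<open>f\<close> into \<open>\<zeta> \<mapsto> \<gamma> \<zeta> + B\<close>, and since
  \<open>\<gamma> < 1\<close> one horodisc size survives every step, so the radii stay away from \<open>0\<close>. Hence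
  \<open>\<Lambda>\<close> consists of the sequences that eventually follow the tangency graph.

  The number of paths of length \<open>n\<close> is \<open>O(t\<^sup>n)\<close> for every \<open>t > \<rho>\<close>, which bounds the dimension
  from above. From below, the entrywise modulus of an eigenvector is a nonnegative \<open>v \<noteq> 0\<close> with
  \<open>A v \<ge> \<rho> v\<close>; given cylinders of small total weight, a path that always moves to a vertex carrying
  more \<open>v\<close>-weight than is covered below it avoids them all.
\<close>

section \<open>Moebius images of discs\<close>

text \<open>The condition \<open>cmod c < cmod d\<close> puts the pole outside the closed disc. The
  formula is imposed on the closed disc only, which keeps the notion stable under composition:
  elsewhere the value \<open>0\<close> at poles can break the formula for a composite.\<close>

definition mob_on_disc :: "complex \<Rightarrow> complex \<Rightarrow> complex \<Rightarrow> complex \<Rightarrow> cfun \<Rightarrow> bool" where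
  "mob_on_disc a b c d f \<longleftrightarrow> a * d - b * c \<noteq> 0 \<and> cmod c < cmod d \<and>
     (\<forall>z\<in>cball 0 1. f z = (a * z + b) / (c * z + d)) \<and> f ` cball 0 1 \<subseteq> cball 0 1"

text \<open>This is the Euclidean radius of the image of the unit disc, as
  \<open>mob_image_cball\<close> confirms.\<close>

definition mob_radius :: "complex \<Rightarrow> complex \<Rightarrow> complex \<Rightarrow> complex \<Rightarrow> real" where
  "mob_radius a b c d = cmod (a * d - b * c) / ((cmod d)\<^sup>2 - (cmod c)\<^sup>2)"

lemma of_real_cmod_square: "(complex_of_real (cmod z))\<^sup>2 = z * cnj z"
  using complex_norm_square[of z] by simp

lemma mob_denom_nonzero:
  fixes c d z :: complex
  assumes "cmod c < cmod d" "cmod z \<le> 1"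
  shows "c * z + d \<noteq> 0"
proof
  assume "c * z + d = 0"
  then have "d = - (c * z)" by (simp add: eq_neg_iff_add_eq_0 add.commute)
  then have "cmod d = cmod c * cmod z" by (simp add: norm_mult)
  also have "\<dots> \<le> cmod c" using assms(2) by (simp add: mult_left_le)
  finally show False using assms(1) by simp
qed

lemma cmod_lt_if_denom_nonzero:
  fixes c d :: complex
  assumes "\<And>z. cmod z \<le> 1 \<Longrightarrow> c * z + d \<noteq> 0"
  shows "cmod c < cmod d"
proof (rule ccontr)
  assume "\<not> cmod c < cmod d"
  then have le: "cmod d \<le> cmod c" by simp
  have "d \<noteq> 0" using assms[of 0] by simp
  then have "c \<noteq> 0" using le by auto
  then have "cmod (- d / c) \<le> 1" using le by (simp add: norm_divide)
  from assms[OF this] show False using \<open>c \<noteq> 0\<close> by simp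
qed

text \<open>The subtracted quotient is the centre of the image of the circle of radius
  \<open>\<rho>\<close> about \<open>0\<close>: by \<open>mob_modulus_identity\<close> the
  right-hand side has constant modulus on that circle.\<close>

lemma mob_center_identity:
  fixes a b c d z :: complex and \<rho> :: real
  assumes "c * z + d \<noteq> 0" and "E \<noteq> 0" and "E = (cmod d)\<^sup>2 - \<rho>\<^sup>2 * (cmod c)\<^sup>2"
  shows "(a * z + b) / (c * z + d) - (b * cnj d - \<rho>\<^sup>2 * a * cnj c) / E
    = (a * d - b * c) * (cnj d * z + \<rho>\<^sup>2 * cnj c) / (E * (c * z + d))"
proof -
  have E: "complex_of_real E = d * cnj d - \<rho>\<^sup>2 * (c * cnj c)"
    unfolding assms(3) by (simp add: of_real_cmod_square)
  have "(a * z + b) * E - (b * cnj d - \<rho>\<^sup>2 * a * cnj c) * (c * z + d)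
    = (a * d - b * c) * (cnj d * z + \<rho>\<^sup>2 * cnj c)"
    unfolding E by (simp add: algebra_simps)
  then show ?thesis using assms(1,2) by (simp add: divide_simps mult_ac)
qed

text \<open>Expanding with \<open>z * cnj z\<close> for squared moduli turns this into a polynomial
  identity. Its sign tells on which side of the circle of radius \<open>r\<close> the point
  \<open>z\<close> lies.\<close>

lemma mob_modulus_identity:
  fixes c d z :: complex and r :: real
  shows "(cmod (cnj d * z + r\<^sup>2 * cnj c))\<^sup>2 - r\<^sup>2 * (cmod (c * z + d))\<^sup>2
    = ((cmod z)\<^sup>2 - r\<^sup>2) * ((cmod d)\<^sup>2 - r\<^sup>2 * (cmod c)\<^sup>2)"
proof -
  have "complex_of_real ((cmod (cnj d * z + r\<^sup>2 * cnj c))\<^sup>2 - r\<^sup>2 * (cmod (c * z + d))\<^sup>2)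
    = complex_of_real (((cmod z)\<^sup>2 - r\<^sup>2) * ((cmod d)\<^sup>2 - r\<^sup>2 * (cmod c)\<^sup>2))"
    by (simp add: of_real_cmod_square) (simp add: algebra_simps power2_eq_square)
  then show ?thesis using of_real_eq_iff by blast
qed

text \<open>The estimate gives the radius \<open>r * cmod (a * d - b * c) / E\<close>, and
  \<open>E\<close> is smallest at \<open>r = 1\<close>, where the quotient
  \<open>cmod (a * d - b * c) / E\<close> becomes \<open>mob_radius\<close>. The factor
  \<open>r\<close> is the contraction that non-edges produce.\<close>

lemma mob_image_small_cball:
  assumes m: "mob_on_disc a b c d f" and r: "0 \<le> r" "r \<le> 1"
  shows "\<exists>C. f ` cball 0 r \<subseteq> cball C (r * mob_radius a b c d)"
proof -
  define E where "E = (cmod d)\<^sup>2 - r\<^sup>2 * (cmod c)\<^sup>2"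
  define C where "C = (b * cnj d - r\<^sup>2 * a * cnj c) / E"
  have cd: "cmod c < cmod d" using m by (simp add: mob_on_disc_def)
  have E1: "0 < (cmod d)\<^sup>2 - (cmod c)\<^sup>2"
    using cd by (simp add: power_strict_mono)
  have "r\<^sup>2 * (cmod c)\<^sup>2 \<le> (cmod c)\<^sup>2" using r by (simp add: mult_left_le_one_le power_le_one)
  then have E2: "(cmod d)\<^sup>2 - (cmod c)\<^sup>2 \<le> E" by (simp add: E_def)
  then have Epos: "E > 0" using E1 by simp
  have "cmod (C - f z) \<le> r * mob_radius a b c d" if z: "cmod z \<le> r" for z
  proof -
    have z1: "cmod z \<le> 1" using z r by simp
    have nz: "c * z + d \<noteq> 0" using mob_denom_nonzero[OF cd z1] .
    have "((cmod z)\<^sup>2 - r\<^sup>2) * E \<le> 0"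
      using z Epos by (simp add: mult_le_0_iff power_mono)
    then have "(cmod (cnj d * z + r\<^sup>2 * cnj c))\<^sup>2 \<le> (r * cmod (c * z + d))\<^sup>2"
      using mob_modulus_identity[of d z r c] by (simp add: E_def power_mult_distrib)
    then have le: "cmod (cnj d * z + r\<^sup>2 * cnj c) \<le> r * cmod (c * z + d)"
      using r by (simp add: power2_le_iff_abs_le)
    have "f z - C = (a * d - b * c) * (cnj d * z + r\<^sup>2 * cnj c) / (E * (c * z + d))"
      using mob_center_identity[OF nz _ E_def, of a b] Epos m z1
      by (simp add: C_def mob_on_disc_def)
    then have "cmod (C - f z) = cmod (a * d - b * c) * cmod (cnj d * z + r\<^sup>2 * cnj c) / (E * cmod (c * z + d))"
      using Epos by (simp add: norm_minus_commute[of C] norm_mult norm_divide)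
    also have "\<dots> \<le> cmod (a * d - b * c) * (r * cmod (c * z + d)) / (E * cmod (c * z + d))"
      using le Epos by (intro divide_right_mono mult_left_mono) auto
    also have "\<dots> = r * (cmod (a * d - b * c) / E)" using nz Epos by simp
    also have "\<dots> \<le> r * mob_radius a b c d"
      unfolding mob_radius_def using E1 E2 r by (intro mult_left_mono divide_left_mono) auto
    finally show ?thesis .
  qed
  then show ?thesis by (intro exI[of _ C]) (auto simp: dist_norm)
qed

text \<open>For a point and its image, membership in the two discs is equivalent by the two
  identities above. The inclusion of the target disc in the image uses the inverse
  transformation.\<close>

lemma mob_image_cball:
  assumes m: "mob_on_disc a b c d f"
  shows "\<exists>C. f ` cball 0 1 = cball C (mob_radius a b c d)"
proof -
  define E where "E = (cmod d)\<^sup>2 - 1\<^sup>2 * (cmod c)\<^sup>2"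
  define C where "C = (b * cnj d - 1\<^sup>2 * a * cnj c) / E"
  define D where "D = a * d - b * c"
  have cd: "cmod c < cmod d" and D0: "D \<noteq> 0" using m by (simp_all add: mob_on_disc_def D_def)
  have Epos: "0 < E"
    using cd by (simp add: power_strict_mono E_def)
  have R: "mob_radius a b c d = cmod D / E" by (simp add: mob_radius_def E_def D_def)
  have key: "cmod (w - C) = cmod D * cmod (cnj d * z + cnj c) / (E * cmod (c * z + d))"
    if "c * z + d \<noteq> 0" "w = (a * z + b) / (c * z + d)" for z w
    using mob_center_identity[OF that(1) _ E_def, of a b] Epos that
    by (simp add: C_def D_def norm_mult norm_divide)
  have iff: "cmod (w - C) \<le> cmod D / E \<longleftrightarrow> cmod z \<le> 1"
    if nz: "c * z + d \<noteq> 0" and w: "w = (a * z + b) / (c * z + d)" for z w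
  proof -
    have "cmod (w - C) \<le> cmod D / E \<longleftrightarrow> cmod (cnj d * z + cnj c) \<le> cmod (c * z + d)"
      unfolding key[OF that] using D0 Epos nz by (simp add: divide_simps mult_ac)
    also have "\<dots> \<longleftrightarrow> (cmod (cnj d * z + cnj c))\<^sup>2 \<le> (cmod (c * z + d))\<^sup>2"
      by (simp add: power2_le_iff_abs_le)
    also have "\<dots> \<longleftrightarrow> ((cmod z)\<^sup>2 - 1) * E \<le> 0"
    proof -
      have "(cmod (cnj d * z + cnj c))\<^sup>2 - (cmod (c * z + d))\<^sup>2 = ((cmod z)\<^sup>2 - 1) * E"
        using mob_modulus_identity[of d z 1 c] by (simp add: E_def)
      then show ?thesis by linarith
    qed
    also have "\<dots> \<longleftrightarrow> (cmod z)\<^sup>2 \<le> 1" using Epos by (simp add: mult_le_0_iff)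
    also have "\<dots> \<longleftrightarrow> cmod z \<le> 1" by (simp add: abs_square_le_1)
    finally show ?thesis .
  qed
  have "f ` cball 0 1 = cball C (cmod D / E)"
  proof (intro equalityI subsetI)
    fix w assume "w \<in> f ` cball 0 1"
    then obtain z where z: "cmod z \<le> 1" "w = f z" by auto
    then have "w = (a * z + b) / (c * z + d)" using m by (simp add: mob_on_disc_def)
    with iff[OF mob_denom_nonzero[OF cd z(1)] this] z show "w \<in> cball C (cmod D / E)"
      by (simp add: dist_norm norm_minus_commute)
  next
    fix w assume "w \<in> cball C (cmod D / E)"
    then have w: "cmod (w - C) \<le> cmod D / E" by (simp add: dist_norm norm_minus_commute)
    \<comment> \<open>A zero here would make \<open>w\<close> the value at infinity, whose distance
      to \<open>C\<close> is \<open>cmod d / cmod c\<close> times the radius and hence too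
      large.\<close>
    have nz: "a - c * w \<noteq> 0"
    proof
      assume "a - c * w = 0"
      then have aw: "a = c * w" by simp
      have EE: "complex_of_real E = d * cnj d - c * cnj c"
        unfolding E_def by (simp add: of_real_cmod_square)
      have EC: "E * C = b * cnj d - a * cnj c" using Epos by (simp add: C_def)
      have "c * (E * (w - C)) = E * (c * w) - c * (E * C)" by (simp add: algebra_simps)
      also have "\<dots> = E * a - c * (b * cnj d - a * cnj c)" by (simp only: EC aw[symmetric])
      also have "\<dots> = cnj d * D" unfolding EE D_def by (simp add: algebra_simps)
      finally have "cmod (c * (E * (w - C))) = cmod (cnj d * D)" by simp
      then have "cmod c * (E * cmod (w - C)) = cmod d * cmod D"
        using Epos by (simp add: norm_mult)
      moreover have "E * cmod (w - C) \<le> cmod D" using w Epos by (simp add: field_simps)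
      then have "cmod c * (E * cmod (w - C)) \<le> cmod c * cmod D" by (simp add: mult_left_mono)
      ultimately show False using cd D0 by simp
    qed
    define z where "z = (d * w - b) / (a - c * w)"
    have "c * z + d = D / (a - c * w)" "a * z + b = w * D / (a - c * w)"
      using nz by (simp_all add: z_def D_def field_simps)
    then have 1: "c * z + d \<noteq> 0" "w = (a * z + b) / (c * z + d)" using D0 nz by simp_all
    then have "cmod z \<le> 1" using iff w by blast
    moreover have "f z = w" using 1 calculation m by (simp add: mob_on_disc_def)
    ultimately show "w \<in> f ` cball 0 1" by force
  qed
  then show ?thesis unfolding R by blast
qed

lemma mob_radius_pos:
  assumes "mob_on_disc a b c d f"
  shows "0 < mob_radius a b c d"
  using assms by (simp add: mob_on_disc_def mob_radius_def power_strict_mono)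

lemma mob_radius_le_1:
  assumes "mob_on_disc a b c d f"
  shows "mob_radius a b c d \<le> 1"
proof -
  obtain C where "f ` cball 0 1 = cball C (mob_radius a b c d)" using mob_image_cball[OF assms] ..
  then have "cball C (mob_radius a b c d) \<subseteq> cball 0 1" using assms by (auto simp: mob_on_disc_def)
  then have "cmod C + mob_radius a b c d \<le> 1"
    using mob_radius_pos[OF assms] by (simp add: cball_subset_cball_iff)
  then show ?thesis using norm_ge_zero[of C] by linarith
qed

lemma mob_on_disc_inj:
  assumes "mob_on_disc a b c d f"
  shows "inj_on f (cball 0 1)"
proof (rule inj_onI)
  fix z w assume z: "z \<in> cball 0 1" and w: "w \<in> cball 0 1" and eq: "f z = f w"
  have cd: "cmod c < cmod d" and D0: "a * d - b * c \<noteq> 0"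
    using assms by (simp_all add: mob_on_disc_def)
  have "(a * z + b) / (c * z + d) = (a * w + b) / (c * w + d)"
    using assms z w eq by (simp add: mob_on_disc_def)
  moreover have "c * z + d \<noteq> 0" "c * w + d \<noteq> 0"
    using mob_denom_nonzero[OF cd] z w by auto
  ultimately have "(a * z + b) * (c * w + d) = (a * w + b) * (c * z + d)"
    by (simp add: divide_simps)
  then have "(a * d - b * c) * (z - w) = 0" by (simp add: algebra_simps)
  then show "z = w" using D0 by simp
qed

lemma mob_on_disc_continuous:
  assumes "mob_on_disc a b c d f"
  shows "continuous_on (cball 0 1) f"
proof -
  have cd: "cmod c < cmod d" using assms by (simp add: mob_on_disc_def)
  have "continuous_on (cball 0 1) (\<lambda>z. (a * z + b) / (c * z + d))"
    using mob_denom_nonzero[OF cd] by (intro continuous_intros) auto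
  then show ?thesis by (rule continuous_on_eq) (use assms in \<open>simp add: mob_on_disc_def\<close>)
qed

lemma mob_on_disc_id: "mob_on_disc 1 0 0 1 id"
  by (simp add: mob_on_disc_def)

text \<open>The coefficients form the matrix product. The pole condition for the product comes from
  the non-vanishing of its denominator on the closed disc, through
  \<open>cmod_lt_if_denom_nonzero\<close>, and not from an estimate of the coefficients.\<close>

lemma mob_on_disc_comp:
  assumes f: "mob_on_disc a b c d f" and g: "mob_on_disc a' b' c' d' g"
  shows "mob_on_disc (a * a' + b * c') (a * b' + b * d') (c * a' + d * c') (c * b' + d * d') (f \<circ> g)"
proof -
  have nz: "c' * z + d' \<noteq> 0" "c * g z + d \<noteq> 0" "g z = (a' * z + b') / (c' * z + d')" "cmod (g z) \<le> 1"
    if "cmod z \<le> 1" for z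
  proof -
    show gz: "cmod (g z) \<le> 1" using that g by (force simp: mob_on_disc_def)
    show "c' * z + d' \<noteq> 0" using that g mob_denom_nonzero unfolding mob_on_disc_def by blast
    show "c * g z + d \<noteq> 0" using gz f mob_denom_nonzero unfolding mob_on_disc_def by blast
    show "g z = (a' * z + b') / (c' * z + d')" using that g by (simp add: mob_on_disc_def)
  qed
  have den: "(c * a' + d * c') * z + (c * b' + d * d') = (c * g z + d) * (c' * z + d')"
    and num: "(a * a' + b * c') * z + (a * b' + b * d') = (a * g z + b) * (c' * z + d')"
    if "cmod z \<le> 1" for z
    using nz[OF that] by (simp_all add: field_simps)
  show ?thesis unfolding mob_on_disc_def
  proof (intro conjI ballI)
    have "(a * a' + b * c') * (c * b' + d * d') - (a * b' + b * d') * (c * a' + d * c')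
      = (a * d - b * c) * (a' * d' - b' * c')" by (simp add: algebra_simps)
    then show "(a * a' + b * c') * (c * b' + d * d') - (a * b' + b * d') * (c * a' + d * c') \<noteq> 0"
      using f g by (simp add: mob_on_disc_def)
    show "cmod (c * a' + d * c') < cmod (c * b' + d * d')"
    proof (rule cmod_lt_if_denom_nonzero)
      fix z assume "cmod z \<le> 1"
      then show "(c * a' + d * c') * z + (c * b' + d * d') \<noteq> 0"
        using nz(1,2)[of z] den[of z] by simp
    qed
    fix z :: complex assume "z \<in> cball 0 1"
    then have z: "cmod z \<le> 1" by simp
    have "f (g z) = (a * g z + b) / (c * g z + d)" using f nz(4)[OF z] by (simp add: mob_on_disc_def)
    then show "(f \<circ> g) z = ((a * a' + b * c') * z + (a * b' + b * d')) / ((c * a' + d * c') * z + (c * b' + d * d'))"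
      unfolding den[OF z] num[OF z] using nz(1)[OF z] by simp
  next
    show "(f \<circ> g) ` cball 0 1 \<subseteq> cball 0 1"
      using f g unfolding mob_on_disc_def by (metis (no_types, lifting) image_comp image_mono subset_trans)
  qed
qed

text \<open>Membership in \<open>MD\<close> controls only the open disc, and the value
  \<open>0\<close> at the pole hides a pole there. Off the pole
  \<open>cmod (a * z + b) \<le> cmod (c * z + d)\<close>, and this extends to the closed disc by
  closure; a pole in it would then be a common zero of numerator and denominator, against the
  determinant condition.\<close>

lemma MD_mob_on_disc:
  assumes "f \<in> MD"
  obtains a b c d where "mob_on_disc a b c d f" "f = (\<lambda>z. (a * z + b) / (c * z + d))"
proof -
  obtain a b c d where D0: "a * d - b * c \<noteq> 0" and f: "f = (\<lambda>z. (a * z + b) / (c * z + d))"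
    using assms unfolding MD_def moebius_def by blast
  have sub: "cmod (f z) < 1" if "cmod z < 1" for z
    using assms that by (auto simp: MD_def unit_disc_def image_subset_iff)
  have cl: "closed {z. cmod (a * z + b) \<le> cmod (c * z + d)}"
    by (intro closed_Collect_le continuous_intros)
  \<comment> \<open>A single point \<open>p\<close> covers all zeros of the denominator. For
    \<open>c = 0\<close> there are none and any \<open>p\<close> will do.\<close>
  obtain p where p: "\<And>z. c * z + d = 0 \<Longrightarrow> z = p"
  proof (cases "c = 0")
    case True
    then have "d \<noteq> 0" using D0 by auto
    then show ?thesis using True that by simp
  next
    case False
    show ?thesis
    proof (rule that[of "- d / c"])
      fix z assume "c * z + d = 0"
      then show "z = - d / c" using False by (simp add: field_simps eq_neg_iff_add_eq_0)
    qed
  qed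
  have "ball 0 1 - {p} \<subseteq> {z. cmod (a * z + b) \<le> cmod (c * z + d)}"
  proof
    fix z assume z: "z \<in> ball 0 1 - {p}"
    then have "c * z + d \<noteq> 0" using p by auto
    moreover have "cmod (f z) < 1" using z sub by simp
    ultimately show "z \<in> {z. cmod (a * z + b) \<le> cmod (c * z + d)}"
      by (simp add: f norm_divide)
  qed
  then have "closure (ball 0 1 - {p}) \<subseteq> {z. cmod (a * z + b) \<le> cmod (c * z + d)}"
    using cl by (rule closure_minimal)
  moreover have "z \<in> closure (ball 0 1 - {p})" if "cmod z \<le> 1" for z
  proof -
    have "z islimpt ball 0 1" using that by (simp add: islimpt_ball)
    then have "z islimpt insert p (ball 0 1 - {p})" by (rule islimpt_subset) auto
    then have "z islimpt (ball 0 1 - {p})" by (simp only: islimpt_insert)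
    then show ?thesis by (simp add: closure_def)
  qed
  ultimately have le: "cmod (a * z + b) \<le> cmod (c * z + d)" if "cmod z \<le> 1" for z
    using that by blast
  have nz: "c * z + d \<noteq> 0" if z: "cmod z \<le> 1" for z
  proof
    assume 0: "c * z + d = 0"
    then have 1: "a * z + b = 0" using le[OF z] by simp
    have "a * d - b * c = a * (c * z + d) - c * (a * z + b)" by (simp add: algebra_simps)
    then show False using 0 1 D0 by simp
  qed
  have "mob_on_disc a b c d f"
    unfolding mob_on_disc_def
    using D0 cmod_lt_if_denom_nonzero[OF nz] f le nz by (auto simp: norm_divide)
  then show thesis using f that by blast
qed

section \<open>Tangency in half-plane coordinates\<close>

lemma MD_image_sphere:
  assumes "f \<in> MD" "cmod z \<le> 1" "cmod (f z) = 1"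
  shows "cmod z = 1"
proof (rule ccontr)
  assume "cmod z \<noteq> 1"
  then have "z \<in> unit_disc" using assms(2) by (simp add: unit_disc_def)
  then have "f z \<in> unit_disc" using assms(1) by (auto simp: MD_def)
  then show False using assms(3) by (simp add: unit_disc_def)
qed

lemma MD_closure_image:
  assumes "f \<in> MD"
  shows "closure (f ` unit_disc) = f ` cball 0 1"
proof -
  obtain a b c d where m: "mob_on_disc a b c d f" using MD_mob_on_disc[OF assms] .
  have cont: "continuous_on (cball 0 1) f" by (rule mob_on_disc_continuous[OF m])
  show ?thesis
  proof
    have "closed (f ` cball 0 1)"
      using cont by (intro compact_imp_closed compact_continuous_image) auto
    then show "closure (f ` unit_disc) \<subseteq> f ` cball 0 1"
      unfolding unit_disc_def by (intro closure_minimal image_mono) auto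
    have "f ` closure unit_disc \<subseteq> closure (f ` unit_disc)"
      using cont by (intro image_closure_subset[OF _ closed_closure closure_subset]) (simp add: unit_disc_def)
    then show "f ` cball 0 1 \<subseteq> closure (f ` unit_disc)" by (simp add: unit_disc_def)
  qed
qed

lemma deriv_mob:
  assumes "f = (\<lambda>z. (a * z + b) / (c * z + d))" "c * z + d \<noteq> (0::complex)"
  shows "deriv f z = (a * d - b * c) / (c * z + d)\<^sup>2"
  unfolding assms(1)
  by (rule DERIV_imp_deriv)
    (use assms(2) in \<open>auto intro!: derivative_eq_intros simp: power2_eq_square field_simps\<close>)

text \<open>Without tangency \<open>alpha f\<close> is \<open>0\<close> by convention, so
  \<open>gamma f\<close> is \<open>(cmod d)\<^sup>2 / cmod (a * d - b * c)\<close>. The image of the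
  disc has radius at most \<open>1\<close>, which bounds this below by \<open>1\<close>.\<close>

lemma gamma_less_1_tangent:
  assumes f: "f \<in> MD" and g: "gamma f < 1"
  shows "tangent f"
proof (rule ccontr)
  assume "\<not> tangent f"
  then have gam: "gamma f = 1 / cmod (deriv f 0)" by (simp add: gamma_def alpha_def)
  obtain a b c d where m: "mob_on_disc a b c d f" and feq: "f = (\<lambda>z. (a * z + b) / (c * z + d))"
    using MD_mob_on_disc[OF f] .
  have cd: "cmod c < cmod d" and D0: "a * d - b * c \<noteq> 0" using m by (simp_all add: mob_on_disc_def)
  then have d0: "d \<noteq> 0" by auto
  have "(cmod c)\<^sup>2 < (cmod d)\<^sup>2" using cd by (simp add: power_strict_mono)
  then have "cmod (a * d - b * c) \<le> (cmod d)\<^sup>2 - (cmod c)\<^sup>2"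
    using mob_radius_le_1[OF m] by (simp add: mob_radius_def divide_simps)
  then have le: "cmod (a * d - b * c) \<le> (cmod d)\<^sup>2" using zero_le_power2[of "cmod c"] by linarith
  have "deriv f 0 = (a * d - b * c) / d\<^sup>2" using deriv_mob[OF feq, of 0] d0 by simp
  then have "cmod (deriv f 0) = cmod (a * d - b * c) / (cmod d)\<^sup>2"
    by (simp add: norm_divide norm_power)
  then have "gamma f = (cmod d)\<^sup>2 / cmod (a * d - b * c)" using gam by simp
  moreover have "0 < cmod (a * d - b * c)" using D0 by simp
  ultimately have "1 \<le> gamma f" using le by (simp only: le_divide_eq_1_pos)
  with g show False by simp
qed

text \<open>Resolves the descriptions in \<open>alpha\<close> and \<open>beta\<close> into actual
  points. Injectivity on the closed disc makes \<open>p\<close> the only point of that disc that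
  \<open>f\<close> sends to the unit circle.\<close>

lemma tangency_points:
  assumes f: "f \<in> MD" and t: "tangent f"
  obtains p q where "alpha f = Some p" "beta f = Some q" "cmod p = 1" "cmod q = 1" "f p = q"
    "\<And>z. cmod z \<le> 1 \<Longrightarrow> cmod (f z) = 1 \<Longrightarrow> z = p" "gamma f = 1 / cmod (deriv f p)"
proof -
  obtain a b c d where m: "mob_on_disc a b c d f" using MD_mob_on_disc[OF f] .
  have ex1: "\<exists>!q. q \<in> sphere 0 1 \<and> q \<in> f ` cball 0 1"
    using t unfolding tangent_def MD_closure_image[OF f] .
  define q where "q = (THE q. q \<in> sphere 0 1 \<and> q \<in> f ` cball 0 1)"
  have q: "q \<in> sphere 0 1 \<and> q \<in> f ` cball 0 1" unfolding q_def by (rule theI'[OF ex1])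
  have quniq: "\<And>w. w \<in> sphere 0 1 \<and> w \<in> f ` cball 0 1 \<Longrightarrow> w = q" using ex1 q by blast
  have bet: "beta f = Some q" using t by (simp add: beta_def q_def MD_closure_image[OF f])
  obtain p where p: "cmod p \<le> 1" "f p = q" using q by auto
  have p1: "cmod p = 1" using MD_image_sphere[OF f p(1)] p(2) q by simp
  have uniq: "z = p" if "cmod z \<le> 1" "cmod (f z) = 1" for z
  proof -
    have "f z = q" using that by (intro quniq) auto
    then show ?thesis using mob_on_disc_inj[OF m] p that(1) by (simp add: inj_on_def)
  qed
  have "(THE a. a \<in> sphere 0 1 \<and> Some (f a) = beta f) = p"
  proof (rule the_equality)
    show "p \<in> sphere 0 1 \<and> Some (f p) = beta f" using p p1 bet by simp
    fix a assume "a \<in> sphere 0 1 \<and> Some (f a) = beta f"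
    then show "a = p" using uniq[of a] bet q by simp
  qed
  then have al: "alpha f = Some p" using t by (simp add: alpha_def)
  show thesis
    by (rule that[OF al bet p1 _ p(2) uniq]) (use q al in \<open>auto simp: gamma_def\<close>)
qed

section \<open>The Cayley transform at a boundary point\<close>

text \<open>For \<open>cmod p = 1\<close> this Cayley transform carries the closed disc without
  \<open>p\<close> onto the closed right half-plane and sends \<open>p\<close> to infinity.\<close>

definition half_plane_coord :: "complex \<Rightarrow> complex \<Rightarrow> complex" where
  "half_plane_coord p z = (p + z) / (p - z)"

definition half_plane_inv :: "complex \<Rightarrow> complex \<Rightarrow> complex" where
  "half_plane_inv p \<zeta> = p * (\<zeta> - 1) / (\<zeta> + 1)"

lemma half_plane_coord_alt:
  "z \<noteq> p \<Longrightarrow> half_plane_coord p z = 2 * p / (p - z) - 1"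
  by (simp add: half_plane_coord_def field_simps)

lemma half_plane_inv:
  assumes "cmod p = 1" "0 \<le> Re \<zeta>"
  shows "cmod (half_plane_inv p \<zeta>) \<le> 1" "half_plane_inv p \<zeta> \<noteq> p"
    "half_plane_coord p (half_plane_inv p \<zeta>) = \<zeta>"
proof -
  have nz: "\<zeta> + 1 \<noteq> 0"
  proof
    assume "\<zeta> + 1 = 0"
    then have "Re (\<zeta> + 1) = 0" by simp
    then show False using assms(2) by simp
  qed
  have p0: "p \<noteq> 0" using assms(1) by auto
  have "(cmod (\<zeta> - 1))\<^sup>2 \<le> (cmod (\<zeta> + 1))\<^sup>2"
    using assms(2) by (simp only: cmod_power2) (simp add: power2_eq_square algebra_simps)
  then have "cmod (\<zeta> - 1) \<le> cmod (\<zeta> + 1)" by (simp add: power2_le_iff_abs_le)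
  then show "cmod (half_plane_inv p \<zeta>) \<le> 1"
    using assms(1) nz by (simp add: half_plane_inv_def norm_mult norm_divide)
  have e1: "p - half_plane_inv p \<zeta> = 2 * p / (\<zeta> + 1)"
    and e2: "p + half_plane_inv p \<zeta> = 2 * p * \<zeta> / (\<zeta> + 1)"
    using nz by (simp_all add: half_plane_inv_def field_simps)
  show "half_plane_inv p \<zeta> \<noteq> p" using e1 nz p0 by auto
  show "half_plane_coord p (half_plane_inv p \<zeta>) = \<zeta>"
    unfolding half_plane_coord_def e1 e2 using nz p0 by simp
qed

lemma half_plane_coord_Re_nonneg:
  assumes "cmod p = 1" "cmod z \<le> 1" "z \<noteq> p"
  shows "0 \<le> Re (half_plane_coord p z)"
proof -
  have "Re (half_plane_coord p z) = Re ((p + z) * cnj (p - z)) / (cmod (p - z))\<^sup>2"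
    by (simp add: half_plane_coord_def complex_div_cnj[of "p + z"] Re_divide_of_real flip: of_real_power)
  also have "Re ((p + z) * cnj (p - z)) = (cmod p)\<^sup>2 - (cmod z)\<^sup>2"
    by (simp only: cmod_power2) (simp add: power2_eq_square algebra_simps)
  finally show ?thesis using assms by (simp add: power_le_one)
qed

lemma half_plane_coord_inj:
  assumes "cmod p = 1" "z \<noteq> p" "w \<noteq> p" "half_plane_coord p z = half_plane_coord p w"
  shows "z = w"
proof -
  have "p \<noteq> 0" using assms(1) by auto
  moreover have "2 * p / (p - z) = 2 * p / (p - w)"
    using assms(2-4) by (simp add: half_plane_coord_alt)
  ultimately show ?thesis using assms(2,3) by (simp add: divide_simps)
qed

text \<open>If \<open>k\<close> had an imaginary part, a point of the imaginary axis would leave the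
  half-plane; if \<open>k\<close> were negative, a large positive real point would.\<close>

lemma half_plane_affine_coeff:
  fixes k B :: complex
  assumes "\<And>\<zeta>. 0 \<le> Re \<zeta> \<Longrightarrow> 0 \<le> Re (k * \<zeta> + B)"
  shows "k = of_real (cmod k)"
proof -
  have im: "Im k = 0"
  proof (rule ccontr)
    assume ne: "Im k \<noteq> 0"
    \<comment> \<open>The point is chosen so that its image has real part exactly
      \<open>-1\<close>.\<close>
    have "0 \<le> Re (k * (\<i> * of_real ((Re B + 1) / Im k)) + B)" by (rule assms) simp
    then show False using ne by simp
  qed
  have re: "0 \<le> Re k"
  proof (rule ccontr)
    assume ne: "\<not> 0 \<le> Re k"
    have "0 \<le> Re (k * of_real ((\<bar>Re B\<bar> + 1) / (- Re k)) + B)"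
      by (rule assms) (use ne in \<open>simp add: divide_nonneg_nonpos\<close>)
    then show False using ne by simp
  qed
  show ?thesis using im re by (simp add: complex_eq_iff cmod_eq_Re)
qed

text \<open>In these coordinates \<open>f\<close> fixes infinity, so it is affine. It preserves the
  right half-plane, so its multiplier is a nonnegative real and equals its modulus
  \<open>1 / cmod (deriv f p)\<close>, which is \<open>gamma f\<close> when \<open>p\<close> is the
  tangency point.\<close>

lemma half_plane_conjugate:
  assumes f: "f \<in> MD" and p: "cmod p = 1" and q: "cmod q = 1" and fp: "f p = q"
  obtains B where "0 \<le> Re B" "\<And>z. cmod z \<le> 1 \<Longrightarrow> z \<noteq> p \<Longrightarrow>
    f z \<noteq> q \<and> half_plane_coord q (f z) = of_real (1 / cmod (deriv f p)) * half_plane_coord p z + B"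
proof -
  obtain a b c d where m: "mob_on_disc a b c d f" and feq: "f = (\<lambda>z. (a * z + b) / (c * z + d))"
    using MD_mob_on_disc[OF f] .
  have cd: "cmod c < cmod d" and D0: "a * d - b * c \<noteq> 0" using m by (simp_all add: mob_on_disc_def)
  define D where "D = a * d - b * c"
  \<comment> \<open>Here \<open>k\<close> equals \<open>q / (p * deriv f p)\<close>. The constant
    \<open>B\<close> collects what is left of \<open>2 * q / (q - f z) - 1\<close> once
    \<open>k * half_plane_coord p z\<close> is split off.\<close>
  define k where "k = q * (c * p + d)\<^sup>2 / (p * D)"
  define B where "B = k - 2 * p * k * c / (c * p + d) - 1"
  have D: "D \<noteq> 0" using D0 by (simp add: D_def)
  have p0: "p \<noteq> 0" and q0: "q \<noteq> 0" using p q by auto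
  have np: "c * p + d \<noteq> 0" using mob_denom_nonzero[OF cd] p by simp
  have conj: "f z \<noteq> q \<and> half_plane_coord q (f z) = k * half_plane_coord p z + B"
    if z: "cmod z \<le> 1" "z \<noteq> p" for z
  proof -
    have nz: "c * z + d \<noteq> 0" using mob_denom_nonzero[OF cd] z by simp
    have diff: "q - f z = D * (p - z) / ((c * p + d) * (c * z + d))"
      unfolding fp[symmetric] feq D_def using np nz by (simp add: divide_simps) (simp add: algebra_simps)
    have ne: "f z \<noteq> q" using diff D np nz z by auto
    have "2 * q / (q - f z) = 2 * q * (c * p + d) * (c * z + d) / (D * (p - z))"
      unfolding diff by simp
    \<comment> \<open>The pole separates from the constant by writing
      \<open>c * z + d = (c * p + d) - c * (p - z)\<close>.\<close>
    also have "\<dots> = k * (2 * p / (p - z)) - 2 * p * k * c / (c * p + d)"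
    proof -
      have pz: "p - z \<noteq> 0" using z by simp
      have "k * (2 * p / (p - z)) - 2 * p * k * c / e = 2 * q * e\<^sup>2 / (D * (p - z)) - 2 * q * c * e / D"
        if "e \<noteq> 0" "k = q * e\<^sup>2 / (p * D)" for e
        using p0 that pz D by (simp add: power2_eq_square mult_ac)
      from this[OF np k_def] have "k * (2 * p / (p - z)) - 2 * p * k * c / (c * p + d)
        = 2 * q * (c * p + d)\<^sup>2 / (D * (p - z)) - 2 * q * c * (c * p + d) / D" .
      also have "\<dots> = 2 * q * (c * p + d) * (c * z + d) / (D * (p - z))"
        using pz D by (simp add: divide_simps power2_eq_square) (simp add: algebra_simps)
      finally show ?thesis by simp
    qed
    finally show ?thesis using ne z by (simp add: half_plane_coord_alt B_def algebra_simps)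
  qed
  have pres: "0 \<le> Re (k * \<zeta> + B)" if "0 \<le> Re \<zeta>" for \<zeta>
  proof -
    let ?z = "half_plane_inv p \<zeta>"
    note inv = half_plane_inv[OF p that]
    have "cmod (f ?z) \<le> 1" using m inv(1) by (force simp: mob_on_disc_def)
    then show ?thesis
      using half_plane_coord_Re_nonneg[OF q, of "f ?z"] conj[OF inv(1,2)] inv(3) by simp
  qed
  have "deriv f p = D / (c * p + d)\<^sup>2" using deriv_mob[OF feq np] by (simp add: D_def)
  then have "cmod k = 1 / cmod (deriv f p)"
    using p q by (simp add: k_def norm_mult norm_divide)
  then have "k = of_real (1 / cmod (deriv f p))" using half_plane_affine_coeff[OF pres] by simp
  moreover have "0 \<le> Re B" using pres[of 0] by simp
  ultimately show thesis using conj that by blast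
qed

section \<open>Limit discs and eventual paths\<close>

lemma comp_seq_Suc: "comp_seq s (Suc n) = comp_seq s n \<circ> s n"
proof -
  have "foldr (\<circ>) xs g = foldr (\<circ>) xs id \<circ> g" for xs :: "cfun list" and g
    by (induction xs) (auto simp: comp_assoc)
  from this[of "map s [0..<n]" "s n"] show ?thesis by (simp add: comp_seq_def)
qed

lemma comp_seq_0: "comp_seq s 0 = id"
  by (simp add: comp_seq_def)

lemma comp_seq_mob:
  assumes "\<And>n. s n \<in> MD"
  shows "\<exists>a b c d. mob_on_disc a b c d (comp_seq s n)"
proof (induction n)
  case 0
  show ?case unfolding comp_seq_0 using mob_on_disc_id by blast
next
  case (Suc n)
  then obtain a b c d where "mob_on_disc a b c d (comp_seq s n)" by blast
  moreover obtain a' b' c' d' where "mob_on_disc a' b' c' d' (s n)" using MD_mob_on_disc[OF assms] .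
  ultimately show ?case unfolding comp_seq_Suc using mob_on_disc_comp by blast
qed

text \<open>Fixes one sequence of centres and radii for the images of the closed disc. The bound for
  smaller discs is included because it refers to these same radii.\<close>

lemma comp_seq_disc:
  assumes "\<And>n. s n \<in> MD"
  shows "\<exists>C R. (\<forall>n. comp_seq s n ` cball 0 1 = cball (C n) (R n)) \<and> (\<forall>n. 0 < R n) \<and> R 0 = 1 \<and>
    (\<forall>n r. 0 \<le> r \<longrightarrow> r \<le> 1 \<longrightarrow> (\<exists>c. comp_seq s n ` cball 0 r \<subseteq> cball c (r * R n))) \<and>
    (\<forall>n. cball (C (Suc n)) (R (Suc n)) \<subseteq> cball (C n) (R n))"
proof -
  obtain a b c d where m: "\<And>n. mob_on_disc (a n) (b n) (c n) (d n) (comp_seq s n)"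
    using comp_seq_mob[of s, OF assms] by metis
  define R where "R n = mob_radius (a n) (b n) (c n) (d n)" for n
  obtain C where C: "\<And>n. comp_seq s n ` cball 0 1 = cball (C n) (R n)"
    using mob_image_cball[OF m] unfolding R_def by metis
  have pos: "0 < R n" for n unfolding R_def by (rule mob_radius_pos[OF m])
  show ?thesis
  proof (intro exI[of _ C] exI[of _ R] conjI allI impI)
    show "comp_seq s n ` cball 0 1 = cball (C n) (R n)" for n by (rule C)
    show "0 < R n" for n by (rule pos)
    have "cball 0 1 = cball (C 0) (R 0)" using C[of 0] by (simp add: comp_seq_0)
    then show "R 0 = 1" using pos[of 0] by (simp add: cball_eq_cball_iff)
    show "\<exists>c. comp_seq s n ` cball 0 r \<subseteq> cball c (r * R n)" if "0 \<le> r" "r \<le> 1" for n r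
      using mob_image_small_cball[OF m that] by (simp add: R_def)
    fix n
    obtain a' b' c' d' where "mob_on_disc a' b' c' d' (s n)" using MD_mob_on_disc[OF assms] .
    then have "s n ` cball 0 1 \<subseteq> cball 0 1" by (simp only: mob_on_disc_def)
    then have "comp_seq s (Suc n) ` cball 0 1 \<subseteq> comp_seq s n ` cball 0 1"
      by (auto simp: comp_seq_Suc)
    then show "cball (C (Suc n)) (R (Suc n)) \<subseteq> cball (C n) (R n)" by (simp only: C)
  qed
qed

section \<open>Nested discs\<close>

text \<open>Inclusion of discs bounds the drift of the centres by the loss of radius, which yields
  both decreasing radii and Cauchy centres.\<close>

lemma nested_cball_radius_mono:
  fixes C :: "nat \<Rightarrow> complex"
  assumes "\<And>n. 0 < R n" "\<And>n. cball (C (Suc n)) (R (Suc n)) \<subseteq> cball (C n) (R n)" "m \<le> n"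
  shows "dist (C n) (C m) + R n \<le> R m"
proof -
  have "cball (C n) (R n) \<subseteq> cball (C m) (R m)"
    using assms(3) by (rule lift_Suc_antimono_le[of "\<lambda>n. cball (C n) (R n)", rotated]) (rule assms(2))
  then show ?thesis using assms(1)[of n] by (simp add: cball_subset_cball_iff)
qed

text \<open>Centres and radii converge, and the intersection is the disc with the limiting centre
  and radius. Two distinct common points bound all radii below by half their distance, so the
  limiting radius is positive.\<close>

lemma nested_cball_Inter:
  fixes C :: "nat \<Rightarrow> complex"
  assumes pos: "\<And>n. 0 < R n" and nest: "\<And>n. cball (C (Suc n)) (R (Suc n)) \<subseteq> cball (C n) (R n)"
    and sub: "\<And>n. x \<in> cball (C n) (R n) \<and> y \<in> cball (C n) (R n)" and ne: "x \<noteq> y"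
  shows "\<exists>c r. r > 0 \<and> (\<Inter>n\<in>{1..}. cball (C n) (R n)) = cball c r"
proof -
  note mono = nested_cball_radius_mono[of R C, OF pos nest]
  have Rmono: "R n \<le> R m" if "m \<le> n" for m n
    using mono[OF that] zero_le_dist[of "C n" "C m"] by linarith
  then have "decseq R" by (auto simp: decseq_def)
  then obtain r where r: "R \<longlonglongrightarrow> r"
    by (rule decseq_convergent[of R 0]) (use pos in \<open>auto intro: less_imp_le\<close>)
  then have Rconv: "convergent R" by (auto simp: convergent_def)
  have "Cauchy C"
  proof (rule metric_CauchyI)
    fix e :: real assume "0 < e"
    then obtain M where M: "\<And>m n. M \<le> m \<Longrightarrow> M \<le> n \<Longrightarrow> dist (R m) (R n) < e"
      using convergent_Cauchy[OF Rconv] by (metis metric_CauchyD)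
    have "dist (C n) (C m) < e" if "M \<le> m" "m \<le> n" for m n
      using mono[OF that(2)] M[of m n] that by (simp add: dist_real_def)
    then show "\<exists>M. \<forall>m\<ge>M. \<forall>n\<ge>M. dist (C m) (C n) < e"
      by (metis dist_commute nle_le)
  qed
  then obtain c where c: "C \<longlonglongrightarrow> c" using Cauchy_convergent convergent_def by blast
  have "dist x y \<le> 2 * R n" for n
    using sub[of n] dist_triangle3[of x y "C n"] by auto
  then have "dist x y \<le> 2 * r"
    by (intro LIMSEQ_le_const[OF tendsto_mult_left[OF r]]) auto
  then have rpos: "0 < r" using ne by (smt (verit) zero_less_dist_iff)
  have "(\<Inter>n\<in>{1..}. cball (C n) (R n)) = cball c r"
  proof (intro equalityI subsetI)
    fix z assume "z \<in> (\<Inter>n\<in>{1..}. cball (C n) (R n))"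
    then have "\<And>n. 1 \<le> n \<Longrightarrow> dist (C n) z \<le> R n" by auto
    then have "dist c z \<le> r"
      by (intro LIMSEQ_le[OF tendsto_dist[OF c tendsto_const] r]) auto
    then show "z \<in> cball c r" by simp
  next
    fix z assume z: "z \<in> cball c r"
    have "dist c (C n) + r \<le> R n" for n
    proof (rule LIMSEQ_le_const2[OF tendsto_add[OF tendsto_dist[OF c tendsto_const] r]])
      show "\<exists>N. \<forall>m\<ge>N. dist (C m) (C n) + R m \<le> R n" using mono by blast
    qed
    then have "z \<in> cball (C n) (R n)" for n
      using z dist_triangle[of "C n" z c] by (smt (verit) dist_commute mem_cball)
    then show "z \<in> (\<Inter>n\<in>{1..}. cball (C n) (R n))" by blast
  qed
  with rpos show ?thesis by blast
qed

text \<open>A value of \<open>f \<circ> g\<close> on the unit circle forces \<open>g x = p\<close>;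
  then \<open>g x\<close> is itself on the circle, so it is the tangency point of \<open>g\<close>
  and there would be an edge. Compactness turns the pointwise strict inequality into a uniform
  \<open>r < 1\<close>.\<close>

lemma nonedge_contracts:
  assumes f: "f \<in> MD" "tangent f" and g: "g \<in> MD" "tangent g" and ne: "\<not> tedge f g"
  shows "\<exists>r. 0 \<le> r \<and> r < 1 \<and> (f \<circ> g) ` cball 0 1 \<subseteq> cball 0 r"
proof -
  obtain a b c d where mf: "mob_on_disc a b c d f" using MD_mob_on_disc[OF f(1)] .
  obtain a' b' c' d' where mg: "mob_on_disc a' b' c' d' g" using MD_mob_on_disc[OF g(1)] .
  have m: "mob_on_disc (a * a' + b * c') (a * b' + b * d') (c * a' + d * c') (c * b' + d * d') (f \<circ> g)"
    by (rule mob_on_disc_comp[OF mf mg])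
  obtain p q where f1: "alpha f = Some p" "cmod p = 1"
    "\<And>z. cmod z \<le> 1 \<Longrightarrow> cmod (f z) = 1 \<Longrightarrow> z = p" using tangency_points[OF f] by metis
  obtain p' q' where g1: "beta g = Some q'" "g p' = q'"
    "\<And>z. cmod z \<le> 1 \<Longrightarrow> cmod (g z) = 1 \<Longrightarrow> z = p'" using tangency_points[OF g] by metis
  have "continuous_on (cball 0 1) (\<lambda>z. cmod ((f \<circ> g) z))"
    using mob_on_disc_continuous[OF m] by (intro continuous_on_norm)
  then obtain x where x: "x \<in> cball 0 1" "\<And>z. z \<in> cball 0 1 \<Longrightarrow> cmod ((f \<circ> g) z) \<le> cmod ((f \<circ> g) x)"
    using continuous_attains_sup[of "cball (0::complex) 1" "\<lambda>z. cmod ((f \<circ> g) z)"] by auto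
  have gx: "cmod (g x) \<le> 1" using mg x(1) by (force simp: mob_on_disc_def)
  have "cmod (f (g x)) \<noteq> 1"
  proof
    assume "cmod (f (g x)) = 1"
    then have gp: "g x = p" using f1(3) gx by blast
    then have "x = p'" using g1(3) f1(2) x(1) by simp
    then show False using ne gp g1 f1 by (simp add: tedge_def)
  qed
  moreover have "cmod (f (g x)) \<le> 1" using mf gx by (force simp: mob_on_disc_def)
  ultimately have "cmod ((f \<circ> g) x) < 1" by simp
  then show ?thesis using x(2) by (intro exI[of _ "cmod ((f \<circ> g) x)"]) auto
qed

text \<open>Finiteness of \<open>F\<close> gives one contraction factor \<open>K < 1\<close> for all
  non-edges. Infinitely many of them drive the radii to \<open>0\<close>, while a limit disc of
  radius \<open>r\<close> would keep them at least \<open>r\<close>.\<close>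

lemma frequent_nonedges_not_limit_disc:
  assumes fin: "finite F" and F: "F \<subseteq> MD" "\<forall>f\<in>F. tangent f" and s: "s \<in> Omega F"
    and inf: "\<And>N. \<exists>n\<ge>N. \<not> tedge (s n) (s (Suc n))"
  shows "\<not> limit_disc_type s"
proof
  assume "limit_disc_type s"
  then obtain c r where r: "r > 0" "(\<Inter>n\<in>{1..}. comp_seq s n ` cball 0 1) = cball c r"
    by (auto simp: limit_disc_type_def)
  have sF: "s n \<in> F" for n using s by (simp add: Omega_def)
  then have sMD: "\<And>n. s n \<in> MD" using F by blast
  obtain C R where CR: "\<And>n. comp_seq s n ` cball 0 1 = cball (C n) (R n)" "\<And>n. 0 < R n" "R 0 = 1"
    and small: "\<And>n r. 0 \<le> r \<Longrightarrow> r \<le> 1 \<Longrightarrow> \<exists>c. comp_seq s n ` cball 0 r \<subseteq> cball c (r * R n)"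
    and nest: "\<And>n. cball (C (Suc n)) (R (Suc n)) \<subseteq> cball (C n) (R n)"
    using comp_seq_disc[of s, OF sMD] by auto
  have mono: "R n \<le> R m" if "m \<le> n" for m n
    using nested_cball_radius_mono[of R C, OF CR(2) nest that] zero_le_dist[of "C n" "C m"] by linarith
  have "\<forall>f\<in>F. \<forall>g\<in>F. \<not> tedge f g \<longrightarrow> (\<exists>r. 0 \<le> r \<and> r < 1 \<and> (f \<circ> g) ` cball 0 1 \<subseteq> cball 0 r)"
    using nonedge_contracts F by blast
  then obtain k where k: "\<And>f g. f \<in> F \<Longrightarrow> g \<in> F \<Longrightarrow> \<not> tedge f g \<Longrightarrow>
      0 \<le> k f g \<and> k f g < 1 \<and> (f \<circ> g) ` cball 0 1 \<subseteq> cball 0 (k f g)"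
    by metis
  define P where "P = {(f, g) \<in> F \<times> F. \<not> tedge f g}"
  \<comment> \<open>The inserted \<open>0\<close> keeps the maximum meaningful when there are no
    non-edges and makes \<open>K\<close> nonnegative.\<close>
  define K where "K = Max (insert 0 ((\<lambda>(f, g). k f g) ` P))"
  have finP: "finite P" unfolding P_def by (rule finite_subset[of _ "F \<times> F"]) (use fin in auto)
  have K0: "0 \<le> K" unfolding K_def using finP by simp
  have K1: "K < 1" unfolding K_def using finP k by (subst Max_less_iff) (auto simp: P_def)
  have Kk: "k f g \<le> K" if "f \<in> F" "g \<in> F" "\<not> tedge f g" for f g
  proof -
    have "(\<lambda>(f, g). k f g) (f, g) \<le> K"
      unfolding K_def using finP that by (intro Max_ge finite_insert[THEN iffD2] finite_imageI insertI2 imageI) (auto simp: P_def)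
    then show ?thesis by simp
  qed
  have step: "R (Suc (Suc n)) \<le> K * R n" if "\<not> tedge (s n) (s (Suc n))" for n
  proof -
    have "(s n \<circ> s (Suc n)) ` cball 0 1 \<subseteq> cball 0 K"
      using k[OF sF sF that] Kk[OF sF sF that] subset_cball by blast
    moreover have "comp_seq s (Suc (Suc n)) ` cball 0 1 = comp_seq s n ` (s n \<circ> s (Suc n)) ` cball 0 1"
      by (simp add: comp_seq_Suc image_comp comp_assoc)
    ultimately have "comp_seq s (Suc (Suc n)) ` cball 0 1 \<subseteq> comp_seq s n ` cball 0 K"
      by (simp only: image_mono)
    moreover obtain c' where "comp_seq s n ` cball 0 K \<subseteq> cball c' (K * R n)" using small[of K n] K0 K1 by auto
    ultimately have sub: "cball (C (Suc (Suc n))) (R (Suc (Suc n))) \<subseteq> cball c' (K * R n)" by (simp add: CR)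
    show ?thesis using sub CR(2)[of "Suc (Suc n)"] zero_le_dist[of "C (Suc (Suc n))" c']
      unfolding cball_subset_cball_iff by linarith
  qed
  \<comment> \<open>Each non-edge is sought beyond the index already reached, so the two-step
    contractions do not overlap.\<close>
  have "\<exists>n. R n \<le> K ^ j" for j
  proof (induction j)
    case 0
    then show ?case using CR(3) by (intro exI[of _ 0]) simp
  next
    case (Suc j)
    then obtain n where n: "R n \<le> K ^ j" by blast
    obtain m where m: "n \<le> m" "\<not> tedge (s m) (s (Suc m))" using inf by blast
    have "R (Suc (Suc m)) \<le> K * R m" by (rule step[OF m(2)])
    also have "\<dots> \<le> K * K ^ j" using mono[OF m(1)] n K0 by (intro mult_left_mono) auto
    finally show ?case by auto
  qed
  moreover have "r \<le> R n" for n
  proof -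
    \<comment> \<open>The intersection starts at index \<open>1\<close>, so the inclusion is read
      off at \<open>Suc n\<close> and passed back to \<open>n\<close> by nesting.\<close>
    have "cball c r \<subseteq> comp_seq s (Suc n) ` cball 0 1" unfolding r(2)[symmetric] by auto
    then have "cball c r \<subseteq> cball (C n) (R n)" using CR(1) nest by blast
    then show ?thesis using r(1) zero_le_dist[of c "C n"] unfolding cball_subset_cball_iff by linarith
  qed
  ultimately have "r \<le> K ^ j" for j by (metis order_trans)
  then have "r \<le> 0" by (intro LIMSEQ_le_const[OF LIMSEQ_power_zero[of K]]) (use K0 K1 in auto)
  then show False using r(1) by simp
qed

section \<open>Horodiscs along paths\<close>

text \<open>For \<open>M > 0\<close> and \<open>cmod p = 1\<close> this is a closed disc internally
  tangent to the unit circle at \<open>p\<close>, with \<open>p\<close> removed; it shrinks as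
  \<open>M\<close> grows.\<close>

definition horodisc :: "complex \<Rightarrow> real \<Rightarrow> complex set" where
  "horodisc p M = {z. cmod z \<le> 1 \<and> z \<noteq> p \<and> M \<le> Re (half_plane_coord p z)}"

text \<open>The image is the half-plane at level \<open>k * M + Re B\<close>. Since
  \<open>k < 1\<close>, this level is at most \<open>M\<close> as soon as \<open>M\<close> reaches
  \<open>Re B / (1 - k)\<close>, and \<open>0 \<le> M\<close> keeps the preimages inside the closed
  disc.\<close>

lemma horodisc_image:
  assumes f: "f \<in> MD" and pq: "cmod p = 1" "cmod q = 1" "f p = q" and d: "deriv f p \<noteq> 0" "1 / cmod (deriv f p) < 1"
  shows "\<exists>M0. \<forall>M\<ge>M0. 0 \<le> M \<longrightarrow> horodisc q M \<subseteq> f ` horodisc p M"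
proof -
  define k where "k = 1 / cmod (deriv f p)"
  have k: "0 < k" "k < 1" using d by (auto simp: k_def)
  obtain B where B: "0 \<le> Re B" "\<And>z. cmod z \<le> 1 \<Longrightarrow> z \<noteq> p \<Longrightarrow>
    f z \<noteq> q \<and> half_plane_coord q (f z) = of_real k * half_plane_coord p z + B"
    using half_plane_conjugate[OF f pq] unfolding k_def by metis
  have "horodisc q M \<subseteq> f ` horodisc p M" if M: "Re B / (1 - k) \<le> M" "0 \<le> M" for M
  proof
    fix w assume w: "w \<in> horodisc q M"
    define \<zeta> where "\<zeta> = (half_plane_coord q w - B) / of_real k"
    have "M * k \<le> M - Re B" using M(1) k by (simp add: field_simps)
    also have "\<dots> \<le> Re (half_plane_coord q w) - Re B" using w by (simp add: horodisc_def)
    finally have "M \<le> Re \<zeta>" using k by (simp add: \<zeta>_def field_simps)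
    then have "0 \<le> Re \<zeta>" using M(2) by simp
    note inv = half_plane_inv[OF pq(1) this]
    define z where "z = half_plane_inv p \<zeta>"
    have z: "z \<in> horodisc p M" using inv \<open>M \<le> Re \<zeta>\<close> by (simp add: horodisc_def z_def)
    have fz: "f z \<noteq> q" "half_plane_coord q (f z) = half_plane_coord q w"
      using B(2)[of z] z inv(3) k by (simp_all add: horodisc_def z_def \<zeta>_def)
    then have "f z = w" using half_plane_coord_inj[OF pq(2)] w by (simp add: horodisc_def)
    with z show "w \<in> f ` horodisc p M" by blast
  qed
  then show ?thesis by blast
qed

text \<open>From index \<open>N\<close> on, the images of horodiscs of one common size increase
  along the path while the images of the disc decrease. All the latter therefore contain the image
  of one horodisc, hence two distinct points.\<close>

lemma eventual_path_limit_disc: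
  assumes fin: "finite F" and F: "F \<subseteq> MD" "\<forall>f\<in>F. gamma f < 1" and s: "s \<in> Omega F"
    and path: "\<And>n. N \<le> n \<Longrightarrow> tedge (s n) (s (Suc n))"
  shows "limit_disc_type s"
proof -
  have sF: "s n \<in> F" for n using s by (simp add: Omega_def)
  then have sMD: "\<And>n. s n \<in> MD" using F by blast
  have "\<exists>p q M0. alpha f = Some p \<and> beta f = Some q \<and> cmod p = 1 \<and> cmod q = 1 \<and>
      (\<forall>M\<ge>M0. 0 \<le> M \<longrightarrow> horodisc q M \<subseteq> f ` horodisc p M)" if fF: "f \<in> F" for f
  proof -
    have f: "f \<in> MD" "gamma f < 1" using F fF by auto
    obtain p q where pq: "alpha f = Some p" "beta f = Some q" "cmod p = 1" "cmod q = 1" "f p = q"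
      and gam: "gamma f = 1 / cmod (deriv f p)"
      using tangency_points[OF f(1) gamma_less_1_tangent[OF f]] by metis
    obtain a b c d where m: "mob_on_disc a b c d f" and feq: "f = (\<lambda>z. (a * z + b) / (c * z + d))"
      using MD_mob_on_disc[OF f(1)] .
    have "c * p + d \<noteq> 0" using m pq(3) mob_denom_nonzero by (auto simp: mob_on_disc_def)
    then have "deriv f p \<noteq> 0" using m deriv_mob[OF feq] by (simp add: mob_on_disc_def)
    then show ?thesis using horodisc_image[OF f(1) pq(3-5)] pq gam f(2) by auto
  qed
  then obtain P Q M0 where PQ: "\<And>f. f \<in> F \<Longrightarrow> alpha f = Some (P f) \<and> beta f = Some (Q f) \<and> cmod (P f) = 1 \<and> cmod (Q f) = 1 \<and>
      (\<forall>M\<ge>M0 f. 0 \<le> M \<longrightarrow> horodisc (Q f) M \<subseteq> f ` horodisc (P f) M)" by metis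
  \<comment> \<open>One threshold serves every map in the finite set \<open>F\<close>, and the
    inserted \<open>0\<close> makes it nonnegative.\<close>
  define M where "M = Max (insert 0 (M0 ` F))"
  have M: "0 \<le> M" "\<And>f. f \<in> F \<Longrightarrow> M0 f \<le> M" unfolding M_def using fin by auto
  obtain C R where CR: "\<And>n. comp_seq s n ` cball 0 1 = cball (C n) (R n)" "\<And>n. 0 < R n"
    and nest: "\<And>n. cball (C (Suc n)) (R (Suc n)) \<subseteq> cball (C n) (R n)"
    using comp_seq_disc[of s, OF sMD] by auto
  have tail: "comp_seq s N ` horodisc (Q (s N)) M \<subseteq> comp_seq s n ` horodisc (Q (s n)) M" if "N \<le> n" for n
    using that
  proof (induction n rule: dec_induct)
    case base
    then show ?case by simp
  next
    case (step n)
    \<comment> \<open>The edge condition matches the horodisc at the target point of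
      \<open>s (Suc n)\<close> with the one at the source point of \<open>s n\<close>.\<close>
    have e: "Q (s (Suc n)) = P (s n)" using path[OF step(1)] PQ sF by (auto simp: tedge_def)
    have "horodisc (Q (s n)) M \<subseteq> s n ` horodisc (Q (s (Suc n))) M"
      using PQ[OF sF[of n]] M sF by (simp add: e)
    then have "comp_seq s n ` horodisc (Q (s n)) M \<subseteq> comp_seq s (Suc n) ` horodisc (Q (s (Suc n))) M"
      by (force simp: comp_seq_Suc)
    with step show ?case by blast
  qed
  define q where "q = Q (s N)"
  have q: "cmod q = 1" using PQ sF by (simp add: q_def)
  \<comment> \<open>The points with half-plane coordinates \<open>M\<close> and \<open>M + 1\<close>
    serve as the two distinct members of the horodisc.\<close>
  define x y where "x = comp_seq s N (half_plane_inv q (of_real M))"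
    and "y = comp_seq s N (half_plane_inv q (of_real (M + 1)))"
  have in_horo: "half_plane_inv q (of_real M) \<in> horodisc q M" "half_plane_inv q (of_real (M + 1)) \<in> horodisc q M"
    using half_plane_inv[OF q, of "of_real M"] half_plane_inv[OF q, of "of_real (M + 1)"] M(1)
    by (simp_all add: horodisc_def)
  have "half_plane_inv q (of_real M) \<noteq> half_plane_inv q (of_real (M + 1))"
  proof
    assume "half_plane_inv q (of_real M) = half_plane_inv q (of_real (M + 1))"
    then have "complex_of_real M = of_real (M + 1)"
      using half_plane_inv(3)[OF q, of "of_real M"] half_plane_inv(3)[OF q, of "of_real (M + 1)"] M(1)
      by simp
    then show False by (simp only: of_real_eq_iff)
  qed
  moreover have "inj_on (comp_seq s N) (cball 0 1)" using comp_seq_mob[of s, OF sMD] mob_on_disc_inj by blast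
  ultimately have "x \<noteq> y" using in_horo by (auto simp: x_def y_def inj_on_def horodisc_def)
  moreover have "x \<in> cball (C n) (R n) \<and> y \<in> cball (C n) (R n)" for n
  proof -
    have "x \<in> cball (C m) (R m) \<and> y \<in> cball (C m) (R m)" if "N \<le> m" for m
    proof -
      have "horodisc (Q (s m)) M \<subseteq> cball 0 1" by (auto simp: horodisc_def)
      then have "comp_seq s N ` horodisc q M \<subseteq> cball (C m) (R m)"
        using tail[OF that] CR(1) unfolding q_def by blast
      then show ?thesis using in_horo by (auto simp: x_def y_def)
    qed
    \<comment> \<open>For indices below \<open>N\<close> the inclusion comes from nesting, by
      passing to \<open>max n N\<close>.\<close>
    moreover have "cball (C (max n N)) (R (max n N)) \<subseteq> cball (C n) (R n)"
      by (rule lift_Suc_antimono_le[of "\<lambda>n. cball (C n) (R n)"]) (rule nest, simp)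
    ultimately show ?thesis by (meson max.cobounded2 subsetD)
  qed
  ultimately have "\<exists>c r. r > 0 \<and> (\<Inter>n\<in>{1..}. cball (C n) (R n)) = cball c r"
    by (intro nested_cball_Inter[of R C x y] CR(2) nest)
  then show ?thesis by (simp only: limit_disc_type_def CR(1))
qed

text \<open>This closes the geometric half: from here on the maps enter only through the relation
  \<open>tedge\<close>.\<close>

lemma Lambda_eq_eventual_paths:
  assumes "finite F" "F \<subseteq> MD" "\<forall>f\<in>F. gamma f < 1"
  shows "Lambda F = {s \<in> Omega F. \<exists>N. \<forall>n\<ge>N. tedge (s n) (s (Suc n))}"
proof -
  have t: "\<forall>f\<in>F. tangent f" using assms gamma_less_1_tangent by blast
  have "limit_disc_type s \<longleftrightarrow> (\<exists>N. \<forall>n\<ge>N. tedge (s n) (s (Suc n)))" if s: "s \<in> Omega F" for s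
  proof
    assume "limit_disc_type s"
    then show "\<exists>N. \<forall>n\<ge>N. tedge (s n) (s (Suc n))"
      using frequent_nonedges_not_limit_disc[OF assms(1,2) t s] by metis
  next
    assume "\<exists>N. \<forall>n\<ge>N. tedge (s n) (s (Suc n))"
    then obtain N where "\<And>n. N \<le> n \<Longrightarrow> tedge (s n) (s (Suc n))" by blast
    then show "limit_disc_type s" by (rule eventual_path_limit_disc[OF assms s])
  qed
  then show ?thesis unfolding Lambda_def by blast
qed

section \<open>Spectral radius and path counts\<close>

lemma enum_of:
  assumes "finite F"
  shows "distinct (enum_of F)" "set (enum_of F) = F"
proof -
  have "\<exists>xs. distinct xs \<and> set xs = F" using finite_distinct_list[OF assms] by blast
  from someI_ex[OF this] show "distinct (enum_of F)" "set (enum_of F) = F"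
    by (simp_all add: enum_of_def)
qed

lemma adj_mat:
  shows "adj_mat F \<in> carrier_mat (length (enum_of F)) (length (enum_of F))"
    and "i < length (enum_of F) \<Longrightarrow> j < length (enum_of F) \<Longrightarrow>
      adj_mat F $$ (i, j) = (if tedge (enum_of F ! i) (enum_of F ! j) then 1 else 0)"
  by (simp_all add: adj_mat_def Let_def)

lemma sum_adj_mat:
  fixes h :: "cfun \<Rightarrow> 'b::comm_monoid_add"
  assumes "finite F"
  shows "(\<Sum>j<length (enum_of F). if tedge f (enum_of F ! j) then h (enum_of F ! j) else 0)
    = (\<Sum>g\<in>{g \<in> F. tedge f g}. h g)"
proof -
  have "(\<Sum>j<length (enum_of F). if tedge f (enum_of F ! j) then h (enum_of F ! j) else 0)
    = (\<Sum>g\<in>F. if tedge f g then h g else 0)"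
    using enum_of[OF assms] by (intro sum.reindex_bij_betw bij_betw_nth) auto
  also have "\<dots> = (\<Sum>g\<in>{g \<in> F. tedge f g}. h g)" using assms by (simp add: sum.inter_filter)
  finally show ?thesis .
qed

lemma mult_mat_vec_index_sum:
  assumes "A \<in> carrier_mat n n" "x \<in> carrier_vec n" "i < n"
  shows "(A *\<^sub>v x) $ i = (\<Sum>j<n. A $$ (i, j) * x $ j)"
  using assms by (simp add: scalar_prod_def row_def atLeast0LessThan)

text \<open>The entrywise modulus of an eigenvector for an eigenvalue of maximal modulus; this is what
  replaces the Perron-Frobenius eigenvector.\<close>
lemma rho_subinvariant_vector:
  assumes fin: "finite F" and ne: "F \<noteq> {}"
  obtains v :: "cfun \<Rightarrow> real" where "\<And>f. 0 \<le> v f" "\<exists>f\<in>F. 0 < v f"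
    "\<And>f. f \<in> F \<Longrightarrow> rho F * v f \<le> (\<Sum>g\<in>{g \<in> F. tedge f g}. v g)"
proof -
  define xs where "xs = enum_of F"
  define n where "n = length xs"
  define A where "A = adj_mat F"
  have xs: "distinct xs" "set xs = F" using enum_of[OF fin] by (simp_all add: xs_def)
  have A: "A \<in> carrier_mat n n" using adj_mat(1) by (simp add: A_def n_def xs_def)
  have n: "0 < n" using ne xs(2) by (auto simp: n_def)
  obtain l where l: "l \<in> spectrum A" "norm l = rho F"
    using spectral_radius_mem_max(1)[OF A n] by (auto simp: rho_def A_def)
  then obtain x where ev: "eigenvector A x l" by (auto simp: spectrum_def eigenvalue_def)
  then have x: "x \<in> carrier_vec n" "x \<noteq> 0\<^sub>v n" "A *\<^sub>v x = l \<cdot>\<^sub>v x"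
    using A by (auto simp: eigenvector_def)
  \<comment> \<open>The entries of the eigenvector are re-indexed by maps through the inverse of the
    enumeration.\<close>
  define v where "v f = norm (x $ (the_inv_into {..<n} ((!) xs) f))" for f
  have inj: "inj_on ((!) xs) {..<n}" using xs(1) by (simp add: n_def inj_on_nth)
  have v: "v (xs ! i) = norm (x $ i)" if "i < n" for i
    using that by (simp add: v_def the_inv_into_f_f[OF inj])
  show thesis
  proof (rule that)
    show "0 \<le> v f" for f by (simp add: v_def)
    obtain i where i: "i < n" "x $ i \<noteq> 0"
      using x(1,2) by (metis carrier_vecD eq_vecI index_zero_vec)
    then have "0 < v (xs ! i)" by (simp add: v)
    moreover have "xs ! i \<in> F" using i(1) xs(2) by (auto simp: n_def)
    ultimately show "\<exists>f\<in>F. 0 < v f" by blast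
    fix f assume "f \<in> F"
    then obtain i where i: "i < n" "f = xs ! i" using xs(2) by (metis in_set_conv_nth n_def)
    have "l * x $ i = (\<Sum>j<n. A $$ (i, j) * x $ j)"
      using mult_mat_vec_index_sum[OF A x(1) i(1)] x i(1) by simp
    then have "norm (l * x $ i) \<le> (\<Sum>j<n. norm (A $$ (i, j) * x $ j))" by (simp only: norm_sum)
    then have "rho F * v f \<le> (\<Sum>j<n. norm (A $$ (i, j) * x $ j))"
      using i v l(2) by (simp only: norm_mult)
    also have "\<dots> = (\<Sum>j<n. if tedge f (xs ! j) then v (xs ! j) else 0)"
    proof (rule sum.cong)
      fix j assume "j \<in> {..<n}"
      then show "norm (A $$ (i, j) * x $ j) = (if tedge f (xs ! j) then v (xs ! j) else 0)"
        using adj_mat(2)[of i F j] i v by (simp add: A_def n_def xs_def)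
    qed simp
    also have "\<dots> = (\<Sum>g\<in>{g \<in> F. tedge f g}. v g)"
      unfolding n_def xs_def by (rule sum_adj_mat[OF fin])
    finally show "rho F * v f \<le> (\<Sum>g\<in>{g \<in> F. tedge f g}. v g)" .
  qed
qed

section \<open>Growth of path counts\<close>

text \<open>The argument counts edges, so a path counted at \<open>n\<close> has
  \<open>Suc n\<close> vertices; hence the \<open>Suc n\<close> in the prefix counts below.\<close>

primrec path_count :: "cfun set \<Rightarrow> nat \<Rightarrow> cfun \<Rightarrow> nat" where
  "path_count F 0 f = 1"
| "path_count F (Suc n) f = (\<Sum>g\<in>{g \<in> F. tedge f g}. path_count F n g)"

text \<open>Powers unfold with the new factor on the right, whereas \<open>path_count\<close> peels
  off the first edge and needs it on the left.\<close>

lemma pow_mat_Suc_left: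
  assumes "A \<in> carrier_mat n n"
  shows "A ^\<^sub>m Suc k = A * A ^\<^sub>m k"
proof (induction k)
  case 0
  then show ?case using assms by simp
next
  case (Suc k)
  have "A ^\<^sub>m Suc (Suc k) = (A * A ^\<^sub>m k) * A" using Suc by simp
  also have "\<dots> = A * (A ^\<^sub>m k * A)"
    using assms by (intro assoc_mult_mat[of _ n n _ n _ n]) (auto intro: pow_carrier_mat)
  finally show ?case by simp
qed

text \<open>Dividing the adjacency matrix by \<open>t > rho F\<close> brings the spectral radius
  below \<open>1\<close>, so the Jordan form bounds all entries of all powers uniformly. Path counts
  are row sums of powers of the adjacency matrix.\<close>

lemma path_count_growth:
  assumes fin: "finite F" and ne: "F \<noteq> {}" and t: "0 < t" "rho F < t"
  obtains C where "0 \<le> C" "\<And>k f. f \<in> F \<Longrightarrow> real (path_count F k f) \<le> C * t ^ k"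
proof -
  define xs where "xs = enum_of F"
  define n where "n = length xs"
  define A where "A = adj_mat F"
  define B where "B = complex_of_real (1 / t) \<cdot>\<^sub>m A"
  have xs: "distinct xs" "set xs = F" using enum_of[OF fin] by (simp_all add: xs_def)
  have A: "A \<in> carrier_mat n n" using adj_mat(1) by (simp add: A_def n_def xs_def)
  have n: "0 < n" using ne xs(2) by (auto simp: n_def)
  have B: "B \<in> carrier_mat n n" using A by (simp add: B_def)
  \<comment> \<open>An eigenvalue \<open>l\<close> of the scaled matrix gives the eigenvalue
    \<open>t * l\<close> of the adjacency matrix.\<close>
  have "norm l < 1" if "l \<in> spectrum B" for l
  proof -
    obtain x where "eigenvector B x l" using \<open>l \<in> spectrum B\<close> by (auto simp: spectrum_def eigenvalue_def)
    then have x: "x \<in> carrier_vec n" "x \<noteq> 0\<^sub>v n" "B *\<^sub>v x = l \<cdot>\<^sub>v x"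
      using B by (auto simp: eigenvector_def)
    have "A *\<^sub>v x = complex_of_real t \<cdot>\<^sub>v (B *\<^sub>v x)"
    proof (rule eq_vecI)
      fix i assume "i < dim_vec (complex_of_real t \<cdot>\<^sub>v (B *\<^sub>v x))"
      then have i: "i < n" using B by simp
      have "(B *\<^sub>v x) $ i = complex_of_real (1 / t) * (A *\<^sub>v x) $ i"
        unfolding mult_mat_vec_index_sum[OF A x(1) i] mult_mat_vec_index_sum[OF B x(1) i] sum_distrib_left
        using A i by (intro sum.cong) (auto simp: B_def mult.assoc)
      then show "(A *\<^sub>v x) $ i = (complex_of_real t \<cdot>\<^sub>v (B *\<^sub>v x)) $ i"
        using t(1) B i by simp
    qed (use A B in simp)
    then have "A *\<^sub>v x = (complex_of_real t * l) \<cdot>\<^sub>v x" by (simp add: x(3) smult_smult_assoc)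
    then have "eigenvalue A (complex_of_real t * l)"
      unfolding eigenvalue_def eigenvector_def using x A by (intro exI[of _ x]) auto
    then have "norm (complex_of_real t * l) \<le> rho F"
      unfolding rho_def A_def[symmetric]
      by (intro spectral_radius_mem_max(2)[OF A n]) (simp add: spectrum_def)
    then have "t * norm l \<le> rho F" using t(1) by (simp add: norm_mult)
    then have "t * norm l < t" using t(2) by linarith
    then show ?thesis using t(1) by simp
  qed
  then have "spectral_radius B < 1" using spectral_radius_mem_max(1)[OF B n] by auto
  then obtain c where c: "\<And>k. norm_bound (B ^\<^sub>m k) c"
    using spectral_radius_jnf_norm_bound_less_1_upper_triangular[OF B] by blast
  have Bk: "B ^\<^sub>m k \<in> carrier_mat n n" for k using B by (rule pow_carrier_mat)
  have count: "complex_of_nat (path_count F k (xs ! i)) = (\<Sum>j<n. t ^ k * (B ^\<^sub>m k) $$ (i, j))"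
    if "i < n" for i k
    using that
  proof (induction k arbitrary: i)
    case 0
    then show ?case using B by simp
  next
    case (Suc k)
    have "complex_of_nat (path_count F (Suc k) (xs ! i))
        = (\<Sum>l<n. if tedge (xs ! i) (xs ! l) then complex_of_nat (path_count F k (xs ! l)) else 0)"
      unfolding n_def xs_def using sum_adj_mat[OF fin, of _ "\<lambda>g. complex_of_nat (path_count F k g)"] by simp
    also have "\<dots> = (\<Sum>l<n. A $$ (i, l) * (\<Sum>j<n. t ^ k * (B ^\<^sub>m k) $$ (l, j)))"
      using Suc adj_mat(2)[of i F] by (intro sum.cong) (auto simp: A_def n_def xs_def)
    also have "\<dots> = (\<Sum>l<n. \<Sum>j<n. t ^ Suc k * (B $$ (i, l) * (B ^\<^sub>m k) $$ (l, j)))"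
      using Suc.prems A t(1) unfolding sum_distrib_left by (intro sum.cong) (auto simp: B_def field_simps)
    also have "\<dots> = (\<Sum>j<n. \<Sum>l<n. t ^ Suc k * (B $$ (i, l) * (B ^\<^sub>m k) $$ (l, j)))"
      by (rule sum.swap)
    also have "\<dots> = (\<Sum>j<n. t ^ Suc k * (B ^\<^sub>m Suc k) $$ (i, j))"
    proof (rule sum.cong)
      fix j assume "j \<in> {..<n}"
      then have "(B ^\<^sub>m Suc k) $$ (i, j) = (\<Sum>l<n. B $$ (i, l) * (B ^\<^sub>m k) $$ (l, j))"
        unfolding pow_mat_Suc_left[OF B] using Suc.prems B Bk[of k]
        by (simp add: scalar_prod_def atLeast0LessThan)
      then show "(\<Sum>l<n. t ^ Suc k * (B $$ (i, l) * (B ^\<^sub>m k) $$ (l, j))) = t ^ Suc k * (B ^\<^sub>m Suc k) $$ (i, j)"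
        by (simp add: sum_distrib_left)
    qed simp
    finally show ?case .
  qed
  \<comment> \<open>Nonnegativity of \<open>c\<close> is read off from an entry, which exists
    because \<open>0 < n\<close>.\<close>
  have "norm ((B ^\<^sub>m 0) $$ (0, 0)) \<le> c"
    using c[of 0, unfolded norm_bound_def] Bk[of 0] n by (metis carrier_matD)
  then have c0: "0 \<le> c" by (rule order_trans[OF norm_ge_zero])
  show thesis
  proof (rule that)
    show "0 \<le> real n * c" using c0 by simp
    fix k f assume "f \<in> F"
    then obtain i where i: "i < n" "f = xs ! i" using xs(2) by (metis in_set_conv_nth n_def)
    have "real (path_count F k f) = norm (complex_of_nat (path_count F k f))" by simp
    also have "\<dots> \<le> (\<Sum>j<n. norm (t ^ k * (B ^\<^sub>m k) $$ (i, j)))"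
      unfolding i(2) count[OF i(1)] by (rule norm_sum)
    also have "\<dots> \<le> (\<Sum>j<n. t ^ k * c)"
    proof (rule sum_mono)
      fix j assume "j \<in> {..<n}"
      then have "norm ((B ^\<^sub>m k) $$ (i, j)) \<le> c"
        using c[of k, unfolded norm_bound_def] i(1) Bk[of k] by (metis carrier_matD lessThan_iff)
      then show "norm (t ^ k * (B ^\<^sub>m k) $$ (i, j)) \<le> t ^ k * c"
        using t(1) by (simp add: norm_mult norm_power mult_left_mono)
    qed
    finally show "real (path_count F k f) \<le> real n * c * t ^ k" by (simp add: mult_ac)
  qed
qed

section \<open>Hausdorff measure of sequence sets\<close>

lemma hausdorff_measure_nullI:
  assumes "\<And>\<delta> \<epsilon>. 0 < \<delta> \<Longrightarrow> 0 < \<epsilon> \<Longrightarrow> \<exists>U :: nat \<Rightarrow> 'a set. S \<subseteq> (\<Union>i. U i) \<and>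
      (\<forall>i. \<forall>x\<in>U i. \<forall>y\<in>U i. d x y \<le> \<delta>) \<and> (\<Sum>i. ennreal (mdiam d (U i) powr s)) \<le> ennreal \<epsilon>"
  shows "hausdorff_measure d s S = 0"
proof -
  have "hausdorff_delta d s \<delta> S \<le> 0" if \<delta>: "0 < \<delta>" for \<delta>
  proof (rule ennreal_le_epsilon)
    fix e :: real assume "0 < e"
    from assms[OF \<delta> this]
    obtain U where U: "S \<subseteq> (\<Union>i. U i)" "\<forall>i. \<forall>x\<in>U i. \<forall>y\<in>U i. d x y \<le> \<delta>"
      "(\<Sum>i. ennreal (mdiam d (U i) powr s)) \<le> ennreal e" by (elim exE conjE)
    have "hausdorff_delta d s \<delta> S \<le> (\<Sum>i. ennreal (mdiam d (U i) powr s))"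
      unfolding hausdorff_delta_def by (intro INF_lower CollectI conjI U(1,2))
    then show "hausdorff_delta d s \<delta> S \<le> 0 + ennreal e" using U(3) by simp
  qed
  then show ?thesis unfolding hausdorff_measure_def by (auto intro!: antisym SUP_least)
qed

lemma hausdorff_measure_nullD:
  assumes "hausdorff_measure d s S = 0" "0 < \<delta>" "0 < \<epsilon>"
  obtains U :: "nat \<Rightarrow> 'a set" where "S \<subseteq> (\<Union>i. U i)" "\<forall>i. \<forall>x\<in>U i. \<forall>y\<in>U i. d x y \<le> \<delta>"
    "(\<Sum>i. ennreal (mdiam d (U i) powr s)) < ennreal \<epsilon>"
proof -
  have "hausdorff_delta d s \<delta> S \<le> hausdorff_measure d s S"
    unfolding hausdorff_measure_def by (rule SUP_upper) (use assms(2) in simp)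
  then have "hausdorff_delta d s \<delta> S < ennreal \<epsilon>" using assms(1,3) by simp
  then show thesis unfolding hausdorff_delta_def INF_less_iff using that by blast
qed

lemma suminf_ennreal_half_powers:
  assumes "0 \<le> \<epsilon>"
  shows "(\<Sum>i. ennreal (\<epsilon> * (1 / 2) ^ Suc i)) = ennreal \<epsilon>"
proof -
  have "(\<lambda>i. \<epsilon> * (1 / 2) ^ Suc i) sums (\<epsilon> * 1)"
    by (rule sums_mult[OF power_half_series])
  then show ?thesis
    using assms by (intro suminf_ennreal_eq) auto
qed

text \<open>Countable subadditivity for null sets: the set with index \<open>n\<close> gets a cover
  of cost below \<open>\<epsilon> / 2 ^ Suc n\<close>, and \<open>prod_decode\<close> merges the
  double family into one sequence.\<close>

lemma hausdorff_measure_null_UN: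
  fixes A :: "nat \<Rightarrow> 'a set"
  assumes "\<And>n::nat. hausdorff_measure d s (A n) = 0"
  shows "hausdorff_measure d s (\<Union>n. A n) = 0"
proof (rule hausdorff_measure_nullI)
  fix \<delta> \<epsilon> :: real assume pos: "0 < \<delta>" "0 < \<epsilon>"
  define Q where "Q n U \<longleftrightarrow> A n \<subseteq> (\<Union>i. U i) \<and> (\<forall>i. \<forall>x\<in>U i. \<forall>y\<in>U i. d x y \<le> \<delta>) \<and>
     (\<Sum>i. ennreal (mdiam d (U i) powr s)) < ennreal (\<epsilon> * (1 / 2) ^ Suc n)" for n and U :: "nat \<Rightarrow> 'a set"
  have "\<exists>U. Q n U" for n
  proof -
    have "0 < \<epsilon> * (1 / 2) ^ Suc n" using pos(2) by simp
    from assms pos(1) this obtain U :: "nat \<Rightarrow> 'a set" where "A n \<subseteq> (\<Union>i. U i)"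
      "\<forall>i. \<forall>x\<in>U i. \<forall>y\<in>U i. d x y \<le> \<delta>"
      "(\<Sum>i. ennreal (mdiam d (U i) powr s)) < ennreal (\<epsilon> * (1 / 2) ^ Suc n)"
      by (rule hausdorff_measure_nullD)
    then have "Q n U" unfolding Q_def by (intro conjI)
    then show ?thesis by (rule exI[of "Q n" U])
  qed
  then obtain U where U: "\<And>n. Q n (U n)" by metis
  note U' = U[unfolded Q_def]
  have U_cover: "A n \<subseteq> (\<Union>i. U n i)" for n
    by (rule conjunct1[OF U'])
  have U_small: "\<forall>i. \<forall>x\<in>U n i. \<forall>y\<in>U n i. d x y \<le> \<delta>" for n
    by (rule conjunct1[OF conjunct2[OF U']])
  have U_sum: "(\<Sum>i. ennreal (mdiam d (U n i) powr s)) < ennreal (\<epsilon> * (1 / 2) ^ Suc n)" for n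
    by (rule conjunct2[OF conjunct2[OF U']])
  define V where "V j = U (fst (prod_decode j)) (snd (prod_decode j))" for j
  have "(\<Sum>j. ennreal (mdiam d (V j) powr s)) = (\<Sum>n. \<Sum>i. ennreal (mdiam d (U n i) powr s))"
    unfolding V_def
    by (rule suminf_ennreal_2dimen[where f = "\<lambda>p. ennreal (mdiam d (U (fst p) (snd p)) powr s)"]) simp
  also have "\<dots> \<le> (\<Sum>n. ennreal (\<epsilon> * (1 / 2) ^ Suc n))"
    by (intro suminf_le summableI less_imp_le U_sum)
  also have "\<dots> = ennreal \<epsilon>" using pos(2) by (intro suminf_ennreal_half_powers) simp
  finally have sum: "(\<Sum>j. ennreal (mdiam d (V j) powr s)) \<le> ennreal \<epsilon>" .
  have "(\<Union>n. A n) \<subseteq> (\<Union>j. V j)"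
  proof
    fix x assume "x \<in> (\<Union>n. A n)"
    then obtain n i where "x \<in> U n i" using U_cover by blast
    then have "x \<in> V (prod_encode (n, i))" by (simp add: V_def)
    then show "x \<in> (\<Union>j. V j)" by blast
  qed
  moreover have "\<forall>j. \<forall>x\<in>V j. \<forall>y\<in>V j. d x y \<le> \<delta>"
    unfolding V_def using U_small by simp
  ultimately show "\<exists>U. (\<Union>n. A n) \<subseteq> (\<Union>i. U i) \<and> (\<forall>i. \<forall>x\<in>U i. \<forall>y\<in>U i. d x y \<le> \<delta>) \<and>
      (\<Sum>i. ennreal (mdiam d (U i) powr s)) \<le> ennreal \<epsilon>" using sum by blast
qed

text \<open>A finite cover is padded with empty sets, which cost nothing since \<open>mdiam\<close>
  of the empty set is \<open>0\<close> and \<open>0 powr s = 0\<close>.\<close>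

lemma hausdorff_measure_null_finite_covers:
  assumes "\<And>\<delta> \<epsilon>. 0 < \<delta> \<Longrightarrow> 0 < \<epsilon> \<Longrightarrow> \<exists>W (A :: 'i \<Rightarrow> 'a set) b. finite W \<and> S \<subseteq> (\<Union>w\<in>W. A w) \<and>
      (\<forall>w\<in>W. \<forall>x\<in>A w. \<forall>y\<in>A w. d x y \<le> \<delta>) \<and> (\<forall>w\<in>W. mdiam d (A w) powr s \<le> b) \<and> real (card W) * b \<le> \<epsilon>"
  shows "hausdorff_measure d s S = 0"
proof (rule hausdorff_measure_nullI)
  fix \<delta> \<epsilon> :: real assume "0 < \<delta>" "0 < \<epsilon>"
  from assms[OF this] obtain W and A :: "'i \<Rightarrow> 'a set" and b where W: "finite W" "S \<subseteq> (\<Union>w\<in>W. A w)"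
    "\<And>w x y. w \<in> W \<Longrightarrow> x \<in> A w \<Longrightarrow> y \<in> A w \<Longrightarrow> d x y \<le> \<delta>"
    "\<And>w. w \<in> W \<Longrightarrow> mdiam d (A w) powr s \<le> b" "real (card W) * b \<le> \<epsilon>" by blast
  obtain h where h: "bij_betw h {0..<card W} W" using ex_bij_betw_nat_finite[OF W(1)] ..
  then have hW: "h i \<in> W" if "i < card W" for i using that by (auto simp: bij_betw_def)
  define U where "U i = (if i < card W then A (h i) else {})" for i
  have "(\<Sum>i. ennreal (mdiam d (U i) powr s)) = (\<Sum>i<card W. ennreal (mdiam d (U i) powr s))"
    by (rule suminf_finite) (auto simp: U_def mdiam_def)
  also have "\<dots> = ennreal (\<Sum>i<card W. mdiam d (U i) powr s)" by (rule sum_ennreal) simp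
  also have "\<dots> \<le> ennreal (\<Sum>i<card W. b)"
    using W(4) hW by (intro ennreal_leI sum_mono) (simp add: U_def)
  also have "\<dots> \<le> ennreal \<epsilon>" using W(5) by (intro ennreal_leI) simp
  finally have sum: "(\<Sum>i. ennreal (mdiam d (U i) powr s)) \<le> ennreal \<epsilon>" .
  have "S \<subseteq> (\<Union>i. U i)"
  proof
    fix x assume "x \<in> S"
    then obtain w where w: "w \<in> W" "x \<in> A w" using W(2) by blast
    then have "w \<in> h ` {0..<card W}" using h by (simp add: bij_betw_def)
    then obtain i where "i < card W" "h i = w" by auto
    then have "x \<in> U i" using w by (simp add: U_def)
    then show "x \<in> (\<Union>i. U i)" by blast
  qed
  moreover have "\<forall>i. \<forall>x\<in>U i. \<forall>y\<in>U i. d x y \<le> \<delta>" using W(3) hW by (auto simp: U_def)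
  ultimately show "\<exists>U. S \<subseteq> (\<Union>i. U i) \<and> (\<forall>i. \<forall>x\<in>U i. \<forall>y\<in>U i. d x y \<le> \<delta>) \<and>
      (\<Sum>i. ennreal (mdiam d (U i) powr s)) \<le> ennreal \<epsilon>" using sum by blast
qed

section \<open>Cylinders and diameters in sequence space\<close>

definition cylinder :: "nat \<Rightarrow> 'a list \<Rightarrow> (nat \<Rightarrow> 'a) set" where
  "cylinder m w = {s. map s [0..<m] = w}"

text \<open>Agreement on the positions below \<open>m\<close> puts the first difference at 0-based
  position at least \<open>m\<close>; the metric counts from \<open>1\<close>, hence the exponent
  \<open>Suc m\<close>.\<close>

lemma seq_dist_le_if_agree:
  assumes "0 < card F" "\<And>k. k < m \<Longrightarrow> x k = y k"
  shows "seq_dist F x y \<le> 1 / real (card F) ^ Suc m"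
proof (cases "x = y")
  case False
  then have "\<exists>i. x i \<noteq> y i" by auto
  then have "x (LEAST i. x i \<noteq> y i) \<noteq> y (LEAST i. x i \<noteq> y i)" by (rule LeastI_ex)
  then have "m \<le> (LEAST i. x i \<noteq> y i)" using assms(2) not_le by blast
  then have "real (card F) ^ Suc m \<le> real (card F) ^ Suc (LEAST i. x i \<noteq> y i)"
    using assms(1) by (intro power_increasing) auto
  then show ?thesis using False assms(1) by (simp add: seq_dist_def frac_le)
qed (use assms in \<open>simp add: seq_dist_def\<close>)

lemma seq_dist_cylinder:
  assumes "0 < card F" "x \<in> cylinder m w" "y \<in> cylinder m w"
  shows "seq_dist F x y \<le> 1 / real (card F) ^ Suc m"
  using assms by (intro seq_dist_le_if_agree) (auto simp: cylinder_def)

lemma mdiam_le: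
  assumes "0 \<le> b" "\<And>x y. x \<in> U \<Longrightarrow> y \<in> U \<Longrightarrow> d x y \<le> b"
  shows "mdiam d U \<le> b"
proof (cases "U = {}")
  case False
  then have "{d x y |x y. x \<in> U \<and> y \<in> U} \<noteq> {}" by blast
  then have "Sup {d x y |x y. x \<in> U \<and> y \<in> U} \<le> b" using assms(2) by (intro cSup_least) auto
  then show ?thesis using False by (simp add: mdiam_def)
qed (use assms(1) in \<open>simp add: mdiam_def\<close>)

text \<open>The uniform bound \<open>b\<close> makes the real supremum in \<open>mdiam\<close>
  meaningful.\<close>

lemma le_mdiam:
  assumes "x \<in> U" "y \<in> U" "\<And>x y. x \<in> U \<Longrightarrow> y \<in> U \<Longrightarrow> d x y \<le> b"
  shows "d x y \<le> mdiam d U"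
proof -
  have "bdd_above {d x y |x y. x \<in> U \<and> y \<in> U}" using assms(3) by (intro bdd_aboveI[of _ b]) auto
  then show ?thesis using assms(1,2) by (auto simp: mdiam_def intro!: cSup_upper)
qed

lemma mdiam_seq_dist_nonneg: "0 < card F \<Longrightarrow> 0 \<le> mdiam (seq_dist F) U"
proof (cases "U = {}")
  case False
  assume "0 < card F"
  from False obtain x where "x \<in> U" by blast
  then have "seq_dist F x x \<le> mdiam (seq_dist F) U"
    using seq_dist_le_if_agree[OF \<open>0 < card F\<close>, of 0] by (intro le_mdiam[of x U x _ "1 / real (card F) ^ Suc 0"]) auto
  then show ?thesis by (simp add: seq_dist_def)
qed (simp add: mdiam_def)

lemma one_div_power_powr:
  assumes "0 < (a::real)"
  shows "(1 / a ^ m) powr s = (a powr (- s)) ^ m"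
proof -
  have "1 / a ^ m = a powr (- real m)" using assms by (simp add: powr_minus_divide powr_realpow)
  moreover have "(a powr (- s)) ^ m = (a powr (- s)) powr real m" using assms by (simp add: powr_realpow)
  ultimately show ?thesis by (simp add: powr_powr mult.commute)
qed

text \<open>The slack \<open>\<eta>\<close> is only needed for sets of diameter zero, which lie in arbitrarily small cylinders.\<close>
lemma covering_set_in_cylinder:
  assumes N: "2 \<le> card F" and s: "0 < s" and \<eta>: "0 < \<eta>"
  shows "\<exists>m x. (\<forall>y\<in>U. \<forall>k<m. y k = x k) \<and>
    (1 / real (card F) ^ Suc m) powr s \<le> mdiam (seq_dist F) U powr s + \<eta>"
proof (cases "\<exists>x. U \<subseteq> {x}")
  case True
  then obtain x where x: "U \<subseteq> {x}" ..
  define q where "q = real (card F) powr (- s)"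
  have "1 < real (card F) powr s" using N s by simp
  then have q: "0 < q" "q < 1" using N unfolding q_def powr_minus_divide
    by (auto simp only: divide_less_eq_1_pos zero_less_divide_1_iff)
  obtain m where "q ^ m < \<eta>" using real_arch_pow_inv[OF \<eta> q(2)] ..
  then have "q ^ Suc m < \<eta>" using q by (smt (verit) mult_left_le_one_le power_Suc zero_less_power)
  moreover have "(1 / real (card F) ^ Suc m) powr s = q ^ Suc m"
    unfolding q_def by (rule one_div_power_powr) (use N in simp)
  ultimately have "(1 / real (card F) ^ Suc m) powr s \<le> mdiam (seq_dist F) U powr s + \<eta>"
    using powr_ge_zero[of "mdiam (seq_dist F) U" s] by linarith
  then show ?thesis using x by (intro exI[of _ m] exI[of _ x]) auto
next
  case False
  then obtain y z where "y \<in> U" "z \<in> U" "y \<noteq> z" by blast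
  then have ex: "\<exists>m. \<exists>y\<in>U. \<exists>z\<in>U. y m \<noteq> z m" by (meson ext)
  \<comment> \<open>At the first position where two members of \<open>U\<close> differ, such a pair
    has distance exactly \<open>1 / real (card F) ^ Suc m\<close>, while all members agree before
    it.\<close>
  define m where "m = (LEAST m. \<exists>y\<in>U. \<exists>z\<in>U. y m \<noteq> z m)"
  obtain y z where yz: "y \<in> U" "z \<in> U" "y m \<noteq> z m" using LeastI_ex[OF ex] unfolding m_def by blast
  have agree: "a k = b k" if "a \<in> U" "b \<in> U" "k < m" for a b k
    using not_less_Least[of k "\<lambda>m. \<exists>y\<in>U. \<exists>z\<in>U. y m \<noteq> z m"] that unfolding m_def by blast
  have "(LEAST i. y i \<noteq> z i) = m"
  proof (rule Least_equality)
    show "m \<le> i" if "y i \<noteq> z i" for i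
      using agree[OF yz(1,2), of i] that by (cases "i < m") auto
  qed (rule yz(3))
  moreover have "y \<noteq> z" using yz(3) by auto
  ultimately have "1 / real (card F) ^ Suc m = seq_dist F y z" by (simp only: seq_dist_def if_False)
  also have "\<dots> \<le> mdiam (seq_dist F) U"
  proof (rule le_mdiam[OF yz(1,2)])
    show "seq_dist F a b \<le> 1 / real (card F) ^ Suc 0" for a b
      by (rule seq_dist_le_if_agree) (use N in auto)
  qed
  finally have "(1 / real (card F) ^ Suc m) powr s \<le> mdiam (seq_dist F) U powr s"
    using s by (intro powr_mono2) auto
  then have "(1 / real (card F) ^ Suc m) powr s \<le> mdiam (seq_dist F) U powr s + \<eta>" using \<eta> by linarith
  then show ?thesis using agree yz(1) by (intro exI[of _ m] exI[of _ y]) blast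
qed

section \<open>Paths in the tangency graph\<close>

definition paths_from :: "cfun set \<Rightarrow> cfun \<Rightarrow> (nat \<Rightarrow> cfun) set" where
  "paths_from F f = {s \<in> Omega F. s 0 = f \<and> (\<forall>n. tedge (s n) (s (Suc n)))}"

definition eventual_paths :: "cfun set \<Rightarrow> nat \<Rightarrow> (nat \<Rightarrow> cfun) set" where
  "eventual_paths F N = {s \<in> Omega F. \<forall>n\<ge>N. tedge (s n) (s (Suc n))}"

section \<open>Prefix counts and the upper bound\<close>

definition prefixes_of :: "nat \<Rightarrow> (nat \<Rightarrow> 'a) set \<Rightarrow> 'a list set" where
  "prefixes_of m S = (\<lambda>s. map s [0..<m]) ` S"

lemma finite_prefixes_of:
  assumes "finite F" "S \<subseteq> Omega F"
  shows "finite (prefixes_of m S)"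
proof (rule finite_subset)
  show "prefixes_of m S \<subseteq> {xs. set xs \<subseteq> F \<and> length xs = m}"
    using assms(2) by (force simp: prefixes_of_def Omega_def)
  show "finite {xs. set xs \<subseteq> F \<and> length xs = m}" by (rule finite_lists_length_eq[OF assms(1)])
qed

text \<open>A sequence splits into its first letter, with at most one choice for each
  \<open>g\<close>, and a tail in \<open>T g\<close>. This serves both paths, where the letter is
  fixed and \<open>g\<close> runs over its successors, and eventual paths, where the letter is
  \<open>g\<close> itself.\<close>

lemma card_prefixes_Suc:
  assumes fin: "finite F" "finite G" "\<And>g. g \<in> G \<Longrightarrow> T g \<subseteq> Omega F"
    and S: "\<And>s. s \<in> S \<Longrightarrow> \<exists>g\<in>G. s 0 \<in> H g \<and> (\<lambda>k. s (Suc k)) \<in> T g"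
    and H: "\<And>g. g \<in> G \<Longrightarrow> finite (H g) \<and> card (H g) \<le> 1"
  shows "card (prefixes_of (Suc m) S) \<le> (\<Sum>g\<in>G. card (prefixes_of m (T g)))"
proof -
  have finT: "finite (prefixes_of m (T g))" if "g \<in> G" for g
    using finite_prefixes_of[OF fin(1) fin(3)[OF that]] .
  have "prefixes_of (Suc m) S \<subseteq> (\<Union>g\<in>G. (\<lambda>(h, w). h # w) ` (H g \<times> prefixes_of m (T g)))"
  proof
    fix w assume "w \<in> prefixes_of (Suc m) S"
    then obtain s where s: "s \<in> S" "w = map s [0..<Suc m]" by (auto simp: prefixes_of_def)
    then obtain g where g: "g \<in> G" "s 0 \<in> H g" "(\<lambda>k. s (Suc k)) \<in> T g" using S by blast
    then have "(s 0, map (\<lambda>k. s (Suc k)) [0..<m]) \<in> H g \<times> prefixes_of m (T g)"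
      by (auto simp: prefixes_of_def)
    then have "w \<in> (\<lambda>(h, w). h # w) ` (H g \<times> prefixes_of m (T g))"
      unfolding s(2) map_upt_Suc by force
    then show "w \<in> (\<Union>g\<in>G. (\<lambda>(h, w). h # w) ` (H g \<times> prefixes_of m (T g)))" using g(1) by blast
  qed
  then have "card (prefixes_of (Suc m) S) \<le> card (\<Union>g\<in>G. (\<lambda>(h, w). h # w) ` (H g \<times> prefixes_of m (T g)))"
    using fin(2) H finT by (intro card_mono) auto
  also have "\<dots> \<le> (\<Sum>g\<in>G. card ((\<lambda>(h, w). h # w) ` (H g \<times> prefixes_of m (T g))))"
    by (rule card_UN_le[OF fin(2)])
  also have "\<dots> \<le> (\<Sum>g\<in>G. card (prefixes_of m (T g)))"
  proof (rule sum_mono)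
    fix g assume g: "g \<in> G"
    have "card ((\<lambda>(h, w). h # w) ` (H g \<times> prefixes_of m (T g))) \<le> card (H g \<times> prefixes_of m (T g))"
      using H[OF g] finT[OF g] by (intro card_image_le) simp
    also have "\<dots> \<le> 1 * card (prefixes_of m (T g))"
      unfolding card_cartesian_product using H[OF g] by (intro mult_right_mono) auto
    finally show "card ((\<lambda>(h, w). h # w) ` (H g \<times> prefixes_of m (T g))) \<le> card (prefixes_of m (T g))"
      by simp
  qed
  finally show ?thesis .
qed

lemma card_prefixes_paths_from:
  assumes "finite F"
  shows "card (prefixes_of (Suc n) (paths_from F f)) \<le> path_count F n f"
proof (induction n arbitrary: f)
  case 0
  have "prefixes_of (Suc 0) (paths_from F f) \<subseteq> {[f]}" by (auto simp: prefixes_of_def paths_from_def)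
  from card_mono[OF _ this] show ?case by simp
next
  case (Suc n)
  have "card (prefixes_of (Suc (Suc n)) (paths_from F f))
    \<le> (\<Sum>g\<in>{g \<in> F. tedge f g}. card (prefixes_of (Suc n) (paths_from F g)))"
    by (rule card_prefixes_Suc[OF assms, where H = "\<lambda>_. {f}"])
      (use assms in \<open>auto simp: paths_from_def Omega_def\<close>)
  also have "\<dots> \<le> path_count F (Suc n) f" using Suc by (simp add: sum_mono)
  finally show ?case .
qed

text \<open>The first \<open>N\<close> letters are free, and the remaining \<open>Suc n\<close>
  letters form a path with \<open>n\<close> edges.\<close>

lemma card_prefixes_eventual_paths:
  assumes fin: "finite F"
  shows "card (prefixes_of (N + Suc n) (eventual_paths F N)) \<le> card F ^ N * (\<Sum>f\<in>F. path_count F n f)"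
proof (induction N)
  case 0
  have "eventual_paths F 0 = (\<Union>f\<in>F. paths_from F f)"
    by (auto simp: eventual_paths_def paths_from_def Omega_def)
  then have "prefixes_of (Suc n) (eventual_paths F 0) = (\<Union>f\<in>F. prefixes_of (Suc n) (paths_from F f))"
    by (simp only: prefixes_of_def image_UN)
  then have "card (prefixes_of (Suc n) (eventual_paths F 0)) \<le> (\<Sum>f\<in>F. card (prefixes_of (Suc n) (paths_from F f)))"
    using card_UN_le[OF fin] by simp
  also have "\<dots> \<le> (\<Sum>f\<in>F. path_count F n f)" by (intro sum_mono card_prefixes_paths_from fin)
  finally show ?case by simp
next
  case (Suc N)
  have "card (prefixes_of (Suc (N + Suc n)) (eventual_paths F (Suc N)))
    \<le> (\<Sum>g\<in>F. card (prefixes_of (N + Suc n) (eventual_paths F N)))"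
    by (rule card_prefixes_Suc[OF fin, where H = "\<lambda>g. {g}"])
      (use fin in \<open>auto simp: eventual_paths_def Omega_def\<close>)
  also have "\<dots> \<le> card F * (card F ^ N * (\<Sum>f\<in>F. path_count F n f))"
    using Suc by simp
  finally show ?case by (simp add: mult.assoc)
qed

text \<open>With \<open>t\<close> strictly between \<open>rho F\<close> and \<open>card F\<close> to
  the power \<open>s\<close>, there are at most \<open>K * t ^ n\<close> cylinders of cost at most
  \<open>q ^ n\<close> each. Since \<open>t * q < 1\<close>, the total cost tends to
  \<open>0\<close>.\<close>

lemma eventual_paths_null:
  assumes fin: "finite F" and N2: "2 \<le> card F" and s: "0 < s" and rho: "rho F < real (card F) powr s"
  shows "hausdorff_measure (seq_dist F) s (eventual_paths F N) = 0"
proof (rule hausdorff_measure_null_finite_covers)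
  fix \<delta> \<epsilon> :: real assume pos: "0 < \<delta>" "0 < \<epsilon>"
  define a where "a = real (card F)"
  have a: "1 < a" using N2 by (simp add: a_def)
  obtain t where t: "0 < t" "rho F < t" "t < a powr s"
    using dense[of "max 0 (rho F)" "a powr s"] rho a by (auto simp: a_def)
  have ne: "F \<noteq> {}" using N2 by auto
  obtain C where C: "0 \<le> C" "\<And>k f. f \<in> F \<Longrightarrow> real (path_count F k f) \<le> C * t ^ k"
    using path_count_growth[OF fin ne t(1,2)] by blast
  define q where "q = a powr (- s)"
  have q: "0 < q" "q < 1" using a s by (simp_all add: q_def powr_minus_divide)
  have tq: "0 \<le> t * q" "t * q < 1" using t a by (simp_all add: q_def powr_minus_divide)
  \<comment> \<open>The factors account for the free letters, the starting vertices of the path and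
    the growth constant.\<close>
  define K where "K = a ^ N * (a * C)"
  have "(\<lambda>n. K * (t * q) ^ n) \<longlonglongrightarrow> K * 0"
    by (intro tendsto_mult_left LIMSEQ_power_zero) (use tq in simp)
  then have "\<forall>\<^sub>F n in sequentially. K * (t * q) ^ n < \<epsilon>"
    by (rule order_tendstoD(2)) (use pos in simp)
  moreover have "(\<lambda>n. (1 / a) ^ n) \<longlonglongrightarrow> 0" by (rule LIMSEQ_power_zero) (use a in simp)
  then have "\<forall>\<^sub>F n in sequentially. (1 / a) ^ n < \<delta>" by (rule order_tendstoD(2)) (use pos in simp)
  ultimately obtain n where n: "K * (t * q) ^ n < \<epsilon>" "(1 / a) ^ n < \<delta>"
    using eventually_happens[OF eventually_conj] sequentially_bot by blast
  define m where "m = N + Suc n"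
  define W where "W = prefixes_of m (eventual_paths F N)"
  have card: "real (card W) \<le> K * t ^ n"
  proof -
    have "card W \<le> card F ^ N * (\<Sum>f\<in>F. path_count F n f)"
      unfolding W_def m_def by (rule card_prefixes_eventual_paths[OF fin])
    then have "real (card W) \<le> real (card F ^ N * (\<Sum>f\<in>F. path_count F n f))" by (rule of_nat_mono)
    also have "\<dots> = a ^ N * (\<Sum>f\<in>F. real (path_count F n f))" by (simp add: a_def)
    also have "\<dots> \<le> a ^ N * (\<Sum>f\<in>F. C * t ^ n)" using a C by (intro mult_left_mono sum_mono) auto
    also have "\<dots> = K * t ^ n" by (simp add: K_def a_def)
    finally show ?thesis .
  qed
  have dist: "seq_dist F x y \<le> 1 / a ^ Suc m" if "x \<in> cylinder m w" "y \<in> cylinder m w" for x y w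
    using seq_dist_cylinder[OF _ that, of F] N2 by (simp add: a_def)
  \<comment> \<open>The diameter bound is weakened so that its exponent matches the one in the path
    count.\<close>
  have pow: "1 / a ^ Suc m \<le> 1 / a ^ n" using a by (intro divide_left_mono power_increasing) (auto simp: m_def)
  show "\<exists>W (A :: cfun list \<Rightarrow> (nat \<Rightarrow> cfun) set) b. finite W \<and> eventual_paths F N \<subseteq> (\<Union>w\<in>W. A w) \<and>
      (\<forall>w\<in>W. \<forall>x\<in>A w. \<forall>y\<in>A w. seq_dist F x y \<le> \<delta>) \<and>
      (\<forall>w\<in>W. mdiam (seq_dist F) (A w) powr s \<le> b) \<and> real (card W) * b \<le> \<epsilon>"
  proof (intro exI[of _ W] exI[of _ "cylinder m"] exI[of _ "q ^ n"] conjI ballI)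
    show "finite W" unfolding W_def by (rule finite_prefixes_of[OF fin]) (auto simp: eventual_paths_def)
    show "eventual_paths F N \<subseteq> (\<Union>w\<in>W. cylinder m w)" by (auto simp: W_def prefixes_of_def cylinder_def)
    show "seq_dist F x y \<le> \<delta>" if "x \<in> cylinder m w" "y \<in> cylinder m w" for x y w
      using dist[OF that] pow n(2) by (simp add: power_one_over)
    have "mdiam (seq_dist F) (cylinder m w) \<le> 1 / a ^ n" for w
      using dist pow a by (intro mdiam_le) (auto intro: order_trans)
    then have "mdiam (seq_dist F) (cylinder m w) powr s \<le> (1 / a ^ n) powr s" for w
      using s mdiam_seq_dist_nonneg N2 by (intro powr_mono2) auto
    then show "mdiam (seq_dist F) (cylinder m w) powr s \<le> q ^ n" for w
      using a by (simp add: one_div_power_powr q_def)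
    have "real (card W) * q ^ n \<le> K * t ^ n * q ^ n" using card q by (intro mult_right_mono) auto
    also have "\<dots> = K * (t * q) ^ n" by (simp add: power_mult_distrib)
    finally show "real (card W) * q ^ n \<le> \<epsilon>" using n(1) by simp
  qed
qed

text \<open>A greedy walk: subinvariance of \<open>v\<close> always leaves a successor whose cylinder carries more
  \<open>v\<close>-weight than is covered inside it.\<close>
lemma path_avoiding_cylinders:
  fixes x :: "nat \<Rightarrow> nat \<Rightarrow> cfun" and m :: "nat \<Rightarrow> nat" and w v :: "_ \<Rightarrow> real"
  assumes fin: "finite F" and \<rho>: "0 < \<rho>" and v: "\<And>f. 0 \<le> v f"
    and sub: "\<And>f. f \<in> F \<Longrightarrow> \<rho> * v f \<le> (\<Sum>g\<in>{g \<in> F. tedge f g}. v g)"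
    and f0: "f0 \<in> F" and total: "(\<Sum>i. ennreal (w i)) < ennreal (v f0)"
  shows "\<exists>p \<in> paths_from F f0. \<forall>n.
    (\<Sum>i. if n < m i \<and> (\<forall>k\<le>n. x i k = p k) then ennreal (w i) else 0) < ennreal (v (p n) / \<rho> ^ n)"
proof -
  \<comment> \<open>This is the total weight of the given cylinders contained in the cylinder of the
    first \<open>Suc n\<close> letters of \<open>p\<close>; the condition \<open>n < m i\<close>
    ensures that only prescribed letters \<open>x i k\<close> are compared.\<close>
  define S where "S n p = (\<Sum>i. if n < m i \<and> (\<forall>k\<le>n. x i k = p k) then ennreal (w i) else 0)"
    for n and p :: "nat \<Rightarrow> cfun"
  define P where "P n p \<longleftrightarrow> p 0 = f0 \<and> (\<forall>k\<le>n. p k \<in> F) \<and> (\<forall>k<n. tedge (p k) (p (Suc k))) \<and>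
    S n p < ennreal (v (p n) / \<rho> ^ n)" for n and p :: "nat \<Rightarrow> cfun"
  have S_cong: "S n p = S n p'" if "\<And>k. k \<le> n \<Longrightarrow> p k = p' k" for n p p'
    unfolding S_def using that by (intro arg_cong[where f = suminf] ext) auto
  have start: "P 0 (\<lambda>_. f0)"
  proof -
    have "S 0 (\<lambda>_. f0) \<le> (\<Sum>i. ennreal (w i))" unfolding S_def by (intro suminf_le summableI) auto
    then show ?thesis using total f0 by (simp add: P_def)
  qed
  have step: "\<exists>p'. P (Suc n) p' \<and> (\<forall>k\<le>n. p' k = p k)" if Pn: "P n p" for n p
  proof -
    define G where "G = {g \<in> F. tedge (p n) g}"
    have finG: "finite G" using fin by (simp add: G_def)
    have "\<exists>g\<in>G. S (Suc n) (p(Suc n := g)) < ennreal (v g / \<rho> ^ Suc n)"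
    proof (rule ccontr)
      \<comment> \<open>If every successor were too heavily covered, summing over successors and
        using subinvariance would contradict the invariant for \<open>p n\<close>.\<close>
      assume "\<not> (\<exists>g\<in>G. S (Suc n) (p(Suc n := g)) < ennreal (v g / \<rho> ^ Suc n))"
      then have ge: "ennreal (v g / \<rho> ^ Suc n) \<le> S (Suc n) (p(Suc n := g))" if "g \<in> G" for g
        using that by (simp add: not_less)
      have pn: "p n \<in> F" using Pn by (simp add: P_def)
      have "v (p n) / \<rho> ^ n = \<rho> * v (p n) / \<rho> ^ Suc n" using \<rho> by simp
      also have "\<dots> \<le> (\<Sum>g\<in>G. v g) / \<rho> ^ Suc n"
        using sub[OF pn] \<rho> unfolding G_def by (intro divide_right_mono) auto
      also have "\<dots> = (\<Sum>g\<in>G. v g / \<rho> ^ Suc n)" by (simp add: sum_divide_distrib)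
      finally have "ennreal (v (p n) / \<rho> ^ n) \<le> ennreal (\<Sum>g\<in>G. v g / \<rho> ^ Suc n)" by (rule ennreal_leI)
      also have "\<dots> = (\<Sum>g\<in>G. ennreal (v g / \<rho> ^ Suc n))"
        by (rule sum_ennreal[symmetric]) (use v \<rho> in auto)
      also have "\<dots> \<le> (\<Sum>g\<in>G. S (Suc n) (p(Suc n := g)))" by (intro sum_mono ge)
      also have "\<dots> = (\<Sum>i. \<Sum>g\<in>G. if Suc n < m i \<and> (\<forall>k\<le>Suc n. x i k = (p(Suc n := g)) k) then ennreal (w i) else 0)"
        unfolding S_def by (rule suminf_sum[symmetric]) (rule summableI)
      \<comment> \<open>The cylinder with index \<open>i\<close> contributes for at most one
        successor, namely \<open>x i (Suc n)\<close>.\<close>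
      also have "\<dots> \<le> S n p"
        unfolding S_def
      proof (intro suminf_le summableI)
        fix i
        have "(\<Sum>g\<in>G. if Suc n < m i \<and> (\<forall>k\<le>Suc n. x i k = (p(Suc n := g)) k) then ennreal (w i) else 0)
          \<le> (\<Sum>g\<in>G. if g = x i (Suc n) then (if n < m i \<and> (\<forall>k\<le>n. x i k = p k) then ennreal (w i) else 0) else 0)"
        proof (rule sum_mono)
          fix g
          have if_mono: "(if A then c else 0) \<le> (if B then (if C then c else 0) else 0)"
            if "A \<Longrightarrow> B \<and> C" for A B C and c :: ennreal using that by auto
          have imp: "g = x i (Suc n) \<and> n < m i \<and> (\<forall>k\<le>n. x i k = p k)"
            if h: "Suc n < m i \<and> (\<forall>k\<le>Suc n. x i k = (p(Suc n := g)) k)"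
          proof (intro conjI allI impI)
            show "g = x i (Suc n)" using h[THEN conjunct2, rule_format, of "Suc n"] by simp
            show "x i k = p k" if "k \<le> n" for k using h[THEN conjunct2, rule_format, of k] that by simp
            show "n < m i" using h[THEN conjunct1] by simp
          qed
          show "(if Suc n < m i \<and> (\<forall>k\<le>Suc n. x i k = (p(Suc n := g)) k) then ennreal (w i) else 0)
            \<le> (if g = x i (Suc n) then (if n < m i \<and> (\<forall>k\<le>n. x i k = p k) then ennreal (w i) else 0) else 0)"
            by (rule if_mono) (rule imp)
        qed
        also have "\<dots> \<le> (if n < m i \<and> (\<forall>k\<le>n. x i k = p k) then ennreal (w i) else 0)"
          using finG by (simp add: sum.delta)
        finally show "(\<Sum>g\<in>G. if Suc n < m i \<and> (\<forall>k\<le>Suc n. x i k = (p(Suc n := g)) k) then ennreal (w i) else 0)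
          \<le> (if n < m i \<and> (\<forall>k\<le>n. x i k = p k) then ennreal (w i) else 0)" .
      qed
      finally show False using Pn by (simp add: P_def not_less[symmetric])
    qed
    then obtain g where g: "g \<in> F" "tedge (p n) g" "S (Suc n) (p(Suc n := g)) < ennreal (v g / \<rho> ^ Suc n)"
      by (auto simp: G_def)
    have "P (Suc n) (p(Suc n := g))"
      unfolding P_def
    proof (intro conjI allI impI)
      show "(p(Suc n := g)) 0 = f0" using Pn by (simp add: P_def)
      show "(p(Suc n := g)) k \<in> F" if "k \<le> Suc n" for k
        using Pn g(1) that by (auto simp: P_def le_Suc_eq)
      show "tedge ((p(Suc n := g)) k) ((p(Suc n := g)) (Suc k))" if "k < Suc n" for k
        using Pn g(2) that by (auto simp: P_def less_Suc_eq)
      show "S (Suc n) (p(Suc n := g)) < ennreal (v ((p(Suc n := g)) (Suc n)) / \<rho> ^ Suc n)" using g(3) by simp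
    qed
    then show ?thesis by (intro exI[of _ "p(Suc n := g)"]) auto
  qed
  obtain ps where ps: "\<And>n. P n (ps n)" "\<And>n k. k \<le> n \<Longrightarrow> ps (Suc n) k = ps n k"
    using dependent_nat_choice[of P "\<lambda>n p p'. \<forall>k\<le>n. p' k = p k"] start step by metis
  \<comment> \<open>The chosen sequences agree on longer and longer initial segments, so their
    diagonal is the required path.\<close>
  define p where "p n = ps n n" for n
  have p: "ps n k = p k" if "k \<le> n" for n k
    using that by (induction n rule: dec_induct) (auto simp: p_def ps(2))
  have "p n \<in> F" "tedge (p n) (p (Suc n))" "p 0 = f0" for n
    using ps(1)[of n] ps(1)[of "Suc n"] p[of _ "Suc n"] p[of _ n] unfolding P_def by (metis lessI less_imp_le_nat order_refl Suc_leI zero_le)+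
  then have "p \<in> paths_from F f0" by (simp add: paths_from_def Omega_def)
  moreover have "S n p < ennreal (v (p n) / \<rho> ^ n)" for n
    using ps(1)[of n] S_cong[of n "ps n" p] p[of _ n] by (auto simp: P_def)
  ultimately show ?thesis unfolding S_def by blast
qed

text \<open>A cheap cover would give cylinders of total weight below \<open>v f0\<close>. The
  avoiding path still lies in some \<open>U i\<close>, hence in its cylinder, and at the last
  prescribed letter that cylinder alone weighs at least \<open>v (p n) / \<rho> ^ n\<close>.\<close>

lemma paths_not_null:
  assumes fin: "finite F" and N2: "2 \<le> card F" and s: "0 < s" and rho: "real (card F) powr s \<le> rho F"
    and paths: "\<And>f. paths_from F f \<subseteq> L"
  shows "hausdorff_measure (seq_dist F) s L \<noteq> 0"
proof
  assume null: "hausdorff_measure (seq_dist F) s L = 0"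
  define a where "a = real (card F)"
  have a: "1 < a" using N2 by (simp add: a_def)
  have ne: "F \<noteq> {}" using N2 by auto
  define \<rho> where "\<rho> = rho F"
  define q where "q = a powr (- s)"
  have "1 < a powr s" using a s by simp
  then have \<rho>1: "1 < \<rho>" using rho by (simp add: a_def \<rho>_def)
  have q: "0 < q" "1 / \<rho> \<le> q" using a rho \<rho>1 by (auto simp: q_def a_def \<rho>_def powr_minus_divide intro!: divide_left_mono)
  obtain v f0 where v: "\<And>f. 0 \<le> v f" "f0 \<in> F" "0 < v f0"
      "\<And>f. f \<in> F \<Longrightarrow> \<rho> * v f \<le> (\<Sum>g\<in>{g \<in> F. tedge f g}. v g)"
    using rho_subinvariant_vector[OF fin ne] unfolding \<rho>_def by metis
  define V where "V = Max (v ` F)"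
  have V: "v f \<le> V" if "f \<in> F" for f using fin that by (simp add: V_def)
  have Vpos: "0 < V" using V[OF v(2)] v(3) by simp
  \<comment> \<open>Chosen so that twice \<open>\<epsilon>\<close>, for the cover and for the slack,
    times the factor \<open>V * \<rho> / q\<close> equals \<open>v f0 / 2\<close>.\<close>
  define \<epsilon> where "\<epsilon> = v f0 * q / (4 * (V * \<rho>))"
  have \<epsilon>: "0 < \<epsilon>" using v(3) q(1) Vpos \<rho>1 by (simp add: \<epsilon>_def)
  obtain U where U: "L \<subseteq> (\<Union>i. U i)" "(\<Sum>i. ennreal (mdiam (seq_dist F) (U i) powr s)) < ennreal \<epsilon>"
  proof -
    have "0 < (1::real)" by simp
    from null this \<epsilon> show thesis by (rule hausdorff_measure_nullD) (rule that)
  qed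
  have "\<exists>m x. (\<forall>y\<in>U i. \<forall>k<m. y k = x k) \<and>
      (1 / a ^ Suc m) powr s \<le> mdiam (seq_dist F) (U i) powr s + \<epsilon> * (1 / 2) ^ Suc i" for i
    unfolding a_def using \<epsilon> by (intro covering_set_in_cylinder N2 s) simp
  then obtain m x where mx: "\<And>i y k. y \<in> U i \<Longrightarrow> k < m i \<Longrightarrow> y k = x i k"
    "\<And>i. (1 / a ^ Suc (m i)) powr s \<le> mdiam (seq_dist F) (U i) powr s + \<epsilon> * (1 / 2) ^ Suc i"
    by metis
  \<comment> \<open>Since \<open>1 / \<rho> \<le> q\<close>, a cylinder of length
    \<open>Suc n\<close> weighs at least \<open>V / \<rho> ^ n\<close>, which dominates
    \<open>v (p n) / \<rho> ^ n\<close>.\<close>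
  define w where "w i = V * \<rho> * q ^ m i" for i
  have w_le: "w i \<le> V * \<rho> / q * (mdiam (seq_dist F) (U i) powr s + \<epsilon> * (1 / 2) ^ Suc i)" for i
  proof -
    have "q ^ Suc (m i) \<le> mdiam (seq_dist F) (U i) powr s + \<epsilon> * (1 / 2) ^ Suc i"
      using mx(2)[of i] a unfolding q_def by (subst one_div_power_powr[symmetric]) auto
    then have "V * \<rho> / q * q ^ Suc (m i) \<le> V * \<rho> / q * (mdiam (seq_dist F) (U i) powr s + \<epsilon> * (1 / 2) ^ Suc i)"
      using Vpos \<rho>1 q(1) by (intro mult_left_mono) auto
    then show ?thesis using q(1) by (simp add: w_def)
  qed
  have "(\<Sum>i. ennreal (w i)) \<le> (\<Sum>i. ennreal (V * \<rho> / q) *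
      (ennreal (mdiam (seq_dist F) (U i) powr s) + ennreal (\<epsilon> * (1 / 2) ^ Suc i)))"
  proof (intro suminf_le summableI)
    fix i
    have "ennreal (w i) \<le> ennreal (V * \<rho> / q * (mdiam (seq_dist F) (U i) powr s + \<epsilon> * (1 / 2) ^ Suc i))"
      by (rule ennreal_leI[OF w_le])
    also have "\<dots> = ennreal (V * \<rho> / q) * (ennreal (mdiam (seq_dist F) (U i) powr s) + ennreal (\<epsilon> * (1 / 2) ^ Suc i))"
      using Vpos \<rho>1 q(1) \<epsilon> by (subst ennreal_mult) (auto simp: ennreal_plus)
    finally show "ennreal (w i) \<le> \<dots>" .
  qed
  also have "\<dots> = ennreal (V * \<rho> / q) *
      ((\<Sum>i. ennreal (mdiam (seq_dist F) (U i) powr s)) + (\<Sum>i. ennreal (\<epsilon> * (1 / 2) ^ Suc i)))"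
    by (simp only: ennreal_suminf_cmult suminf_add[OF summableI summableI])
  also have "\<dots> \<le> ennreal (V * \<rho> / q) * (ennreal \<epsilon> + ennreal \<epsilon>)"
    using U(2) \<epsilon> by (intro mult_left_mono add_mono) (auto simp only: suminf_ennreal_half_powers less_imp_le zero_le)
  also have "\<dots> = ennreal (V * \<rho> / q * (\<epsilon> + \<epsilon>))"
  proof -
    have c: "0 \<le> V * \<rho> / q" and e: "0 \<le> \<epsilon>" using Vpos \<rho>1 q(1) \<epsilon> by auto
    show ?thesis by (simp only: ennreal_mult[OF c add_nonneg_nonneg[OF e e]] ennreal_plus[OF e e])
  qed
  also have "\<dots> = ennreal (v f0 / 2)" using Vpos \<rho>1 q(1) by (simp add: \<epsilon>_def)
  also have "\<dots> < ennreal (v f0)" using v(3) by (simp add: ennreal_lessI)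
  finally have total: "(\<Sum>i. ennreal (w i)) < ennreal (v f0)" .
  have \<rho>0: "0 < \<rho>" using \<rho>1 by simp
  obtain p where p: "p \<in> paths_from F f0" "\<And>n. (\<Sum>i. if n < m i \<and> (\<forall>k\<le>n. x i k = p k) then ennreal (w i) else 0)
      < ennreal (v (p n) / \<rho> ^ n)"
    using path_avoiding_cylinders[OF fin \<rho>0 v(1) v(4) v(2) total, of m x] by blast
  obtain i where i: "p \<in> U i" using p(1) paths U(1) by blast
  show False
  proof (cases "m i")
    \<comment> \<open>A cylinder of length \<open>0\<close> is the whole space, and its weight alone
      already exceeds the allowed total.\<close>
    case 0
    have "v f0 \<le> V * \<rho> * 1" using V[OF v(2)] Vpos \<rho>1 by (intro order_trans[OF V[OF v(2)]]) simp
    then have "ennreal (v f0) \<le> ennreal (w i)" by (intro ennreal_leI) (simp add: w_def 0)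
    also have "\<dots> \<le> (\<Sum>i. ennreal (w i))" using sum_le_suminf[of "\<lambda>i. ennreal (w i)" "{i}"] by simp
    finally show False using total by simp
  next
    case (Suc n)
    have "p n \<in> F" using p(1) by (simp add: paths_from_def Omega_def)
    then have "v (p n) / \<rho> ^ n \<le> V * \<rho> * (1 / \<rho>) ^ Suc n"
      using V \<rho>0 by (simp add: power_one_over divide_right_mono field_simps)
    also have "\<dots> \<le> w i" unfolding w_def Suc using q \<rho>0 Vpos by (intro mult_left_mono power_mono) auto
    finally have "ennreal (v (p n) / \<rho> ^ n) \<le> ennreal (w i)" by (rule ennreal_leI)
    also have "\<dots> = (if n < m i \<and> (\<forall>k\<le>n. x i k = p k) then ennreal (w i) else 0)"
      using mx(1)[OF i] Suc by auto
    also have "\<dots> \<le> (\<Sum>i. if n < m i \<and> (\<forall>k\<le>n. x i k = p k) then ennreal (w i) else 0)"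
      using sum_le_suminf[of "\<lambda>i. if n < m i \<and> (\<forall>k\<le>n. x i k = p k) then ennreal (w i) else 0" "{i}"] by simp
    finally show False using p(2)[of n] by simp
  qed
qed

section \<open>Cycles and the value of the dimension\<close>

lemma cycle_path:
  assumes "has_cycle F"
  obtains f where "f \<in> F" "paths_from F f \<noteq> {}"
proof -
  obtain n x where n: "1 \<le> n" and xF: "\<And>i. i \<le> n \<Longrightarrow> x i \<in> F" and x0: "x 0 = x n"
    and edge: "\<And>i. i < n \<Longrightarrow> tedge (x i) (x (Suc i))"
    using assms by (auto simp: has_cycle_def)
  \<comment> \<open>The cycle is repeated periodically; \<open>x 0 = x n\<close> supplies the edge
    at each return.\<close>
  define s where "s i = x (i mod n)" for i
  have "tedge (s i) (s (Suc i))" for i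
    using edge[of "i mod n"] n x0 by (auto simp: s_def mod_Suc)
  moreover have "s i \<in> F" for i using xF[of "i mod n"] n by (simp add: s_def)
  ultimately have "s \<in> paths_from F (s 0)" by (simp add: paths_from_def Omega_def)
  then show thesis using that \<open>\<And>i. s i \<in> F\<close> by blast
qed

text \<open>By the pigeonhole principle the path part of the sequence revisits a vertex, and the
  segment between two visits is a cycle.\<close>

lemma cycle_if_eventual_path:
  assumes "finite F" "s \<in> eventual_paths F N"
  shows "has_cycle F"
proof -
  have sF: "\<And>n. s n \<in> F" and edge: "\<And>n. N \<le> n \<Longrightarrow> tedge (s n) (s (Suc n))"
    using assms(2) by (auto simp: eventual_paths_def Omega_def)
  have "\<not> inj (\<lambda>k. s (N + k))"
  proof
    assume "inj (\<lambda>k. s (N + k))"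
    moreover have "finite (range (\<lambda>k. s (N + k)))"
      by (rule finite_subset[OF _ assms(1)]) (use sF in auto)
    ultimately show False using finite_imageD infinite_UNIV_nat by blast
  qed
  then obtain a b where ab: "a < b" "s (N + a) = s (N + b)"
    unfolding inj_def by (metis linorder_neqE_nat)
  have "1 \<le> b - a \<and> (\<forall>i\<le>b - a. s (N + a + i) \<in> F) \<and> s (N + a + 0) = s (N + a + (b - a)) \<and>
      (\<forall>i<b - a. tedge (s (N + a + i)) (s (N + a + Suc i)))"
    using ab sF edge by simp
  then show ?thesis unfolding has_cycle_def by (intro exI[of _ "b - a"] exI[of _ "\<lambda>i. s (N + a + i)"])
qed

text \<open>If \<open>rho F < 1\<close>, path counts would decay geometrically, but a cycle yields
  an infinite path and hence at least one path of every length.\<close>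

lemma rho_ge_1:
  assumes fin: "finite F" and cyc: "has_cycle F"
  shows "1 \<le> rho F"
proof (rule ccontr)
  assume "\<not> 1 \<le> rho F"
  then obtain t where t: "0 < t" "rho F < t" "t < 1" using dense[of "max 0 (rho F)" 1] by auto
  obtain f where f: "f \<in> F" "paths_from F f \<noteq> {}" using cycle_path[OF cyc] .
  then have "F \<noteq> {}" by blast
  then obtain C where C: "0 \<le> C" "\<And>k f. f \<in> F \<Longrightarrow> real (path_count F k f) \<le> C * t ^ k"
    using path_count_growth[OF fin _ t(1,2)] by blast
  have "1 \<le> C * t ^ k" for k
  proof -
    have "finite (prefixes_of (Suc k) (paths_from F f))"
      by (rule finite_prefixes_of[OF fin]) (auto simp: paths_from_def)
    then have "0 < card (prefixes_of (Suc k) (paths_from F f))"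
      using f(2) by (simp add: card_gt_0_iff prefixes_of_def)
    then have "1 \<le> path_count F k f" using card_prefixes_paths_from[OF fin, of k f] by linarith
    then show ?thesis using C(2)[OF f(1), of k] by linarith
  qed
  moreover have "(\<lambda>k. C * t ^ k) \<longlonglongrightarrow> C * 0"
    by (intro tendsto_mult_left LIMSEQ_power_zero) (use t in simp)
  ultimately have "1 \<le> C * 0" by (intro LIMSEQ_le_const) auto
  then show False by simp
qed

text \<open>Each exponent on either side of \<open>D\<close> is handled by its own assumption, so
  measures at different exponents are never compared. For \<open>D = 0\<close> the lower range is
  empty.\<close>

lemma hausdorff_dim_eqI:
  assumes "0 \<le> D" "\<And>s. 0 < s \<Longrightarrow> D < s \<Longrightarrow> hausdorff_measure d s S = 0"
    "\<And>s. 0 < s \<Longrightarrow> s < D \<Longrightarrow> hausdorff_measure d s S \<noteq> 0"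
  shows "hausdorff_dim d S = ereal D"
proof (rule antisym)
  show "hausdorff_dim d S \<le> ereal D"
  proof (rule ereal_le_epsilon2)
    fix e :: real assume "0 < e"
    then have "hausdorff_dim d S \<le> ereal (D + e)"
      unfolding hausdorff_dim_def using assms(1) by (intro Inf_lower) (auto intro!: assms(2))
    then show "hausdorff_dim d S \<le> ereal D + ereal e" by simp
  qed
  show "ereal D \<le> hausdorff_dim d S"
    unfolding hausdorff_dim_def using assms(3) by (intro Inf_greatest) (force simp: not_less[symmetric])
qed

text \<open>With one map there is only one sequence, so a single set of diameter \<open>0\<close>
  covers everything at no cost.\<close>

lemma hausdorff_measure_seq_dist_singleton:
  assumes "card F = 1" "0 < s" "S \<subseteq> Omega F"
  shows "hausdorff_measure (seq_dist F) s S = 0"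
proof (rule hausdorff_measure_null_finite_covers)
  fix \<delta> \<epsilon> :: real assume pos: "0 < \<delta>" "0 < \<epsilon>"
  have eq: "x = y" if "x \<in> S" "y \<in> S" for x y
  proof
    fix n
    obtain f where "F = {f}" using assms(1) card_1_singletonE by blast
    moreover have "x \<in> Omega F" "y \<in> Omega F" using that assms(3) by auto
    ultimately show "x n = y n" by (simp add: Omega_def)
  qed
  then have zero: "seq_dist F x y = 0" if "x \<in> S" "y \<in> S" for x y
    using that by (simp add: seq_dist_def)
  have "mdiam (seq_dist F) S \<le> 0" by (rule mdiam_le) (simp_all add: zero)
  moreover have "0 \<le> mdiam (seq_dist F) S" by (rule mdiam_seq_dist_nonneg) (use assms(1) in simp)
  ultimately have "mdiam (seq_dist F) S = 0" by simp
  then show "\<exists>W (A :: unit \<Rightarrow> (nat \<Rightarrow> cfun) set) b. finite W \<and> S \<subseteq> (\<Union>w\<in>W. A w) \<and>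
      (\<forall>w\<in>W. \<forall>x\<in>A w. \<forall>y\<in>A w. seq_dist F x y \<le> \<delta>) \<and>
      (\<forall>w\<in>W. mdiam (seq_dist F) (A w) powr s \<le> b) \<and> real (card W) * b \<le> \<epsilon>"
    using zero pos by (intro exI[of _ UNIV] exI[of _ "\<lambda>_. S"] exI[of _ 0]) auto
qed

theorem theorem1p3:
  fixes F :: "(complex \<Rightarrow> complex) set"
  assumes "finite F" and "F \<subseteq> MD" and "\<forall>f\<in>F. gamma f < 1"
  shows "(has_cycle F \<longrightarrow>
            hausdorff_dim (seq_dist F) (Lambda F) = ereal (ln (rho F) / ln (real (card F)))) \<and>
         (\<not> has_cycle F \<longrightarrow> hausdorff_dim (seq_dist F) (Lambda F) = 0)"
proof -
  \<comment> \<open>Writing the set as a countable union over the starting index lets the upper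
    bound treat each \<open>N\<close> separately.\<close>
  have Lambda: "Lambda F = (\<Union>N. eventual_paths F N)"
    unfolding Lambda_eq_eventual_paths[OF assms] by (auto simp: eventual_paths_def)
  have "hausdorff_dim (seq_dist F) (Lambda F) = ereal (ln (rho F) / ln (real (card F)))" if cyc: "has_cycle F"
  proof (cases "card F = 1")
    \<comment> \<open>Here \<open>ln (real (card F))\<close> is \<open>0\<close> and division by
      zero gives \<open>0\<close>, so the claim is that the dimension is \<open>0\<close>.\<close>
    case True
    have "Lambda F \<subseteq> Omega F" by (auto simp: Lambda_def)
    then show ?thesis
      using hausdorff_measure_seq_dist_singleton[OF True] True by (intro hausdorff_dim_eqI) auto
  next
    case False
    obtain f where "f \<in> F" using cycle_path[OF cyc] .
    then have "card F \<noteq> 0" using assms(1) by auto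
    with False have N2: "2 \<le> card F" by linarith
    have rho: "1 \<le> rho F" by (rule rho_ge_1[OF assms(1) cyc])
    have ln: "0 < ln (real (card F))" using N2 by simp
    \<comment> \<open>Both bounds use this equivalence: the upper bound directly, the lower bound
      through its negation.\<close>
    have less_iff: "rho F < real (card F) powr s \<longleftrightarrow> ln (rho F) / ln (real (card F)) < s" for s
    proof -
      have "rho F < real (card F) powr s \<longleftrightarrow> ln (rho F) < ln (real (card F) powr s)"
        using rho N2 by (subst ln_less_cancel_iff) auto
      also have "\<dots> \<longleftrightarrow> ln (rho F) / ln (real (card F)) < s"
        using ln N2 by (simp add: ln_powr divide_simps)
      finally show ?thesis .
    qed
    show ?thesis
    proof (rule hausdorff_dim_eqI)
      show "0 \<le> ln (rho F) / ln (real (card F))" using rho ln by simp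
      fix s :: real assume s: "0 < s"
      show "hausdorff_measure (seq_dist F) s (Lambda F) = 0" if "ln (rho F) / ln (real (card F)) < s"
        unfolding Lambda using that less_iff
        by (intro hausdorff_measure_null_UN eventual_paths_null assms(1) N2 s) blast
      show "hausdorff_measure (seq_dist F) s (Lambda F) \<noteq> 0" if "s < ln (rho F) / ln (real (card F))"
      proof (rule paths_not_null[OF assms(1) N2 s])
        show "real (card F) powr s \<le> rho F" using that less_iff[of s] by linarith
        show "paths_from F f \<subseteq> Lambda F" for f
          unfolding Lambda by (auto simp: paths_from_def eventual_paths_def)
      qed
    qed
  qed
  moreover have "hausdorff_dim (seq_dist F) (Lambda F) = 0" if "\<not> has_cycle F"
  proof -
    \<comment> \<open>Without a cycle no sequence follows edges eventually, so the set is empty and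
      every positive exponent gives measure \<open>0\<close>.\<close>
    have empty: "Lambda F = {}" using cycle_if_eventual_path[OF assms(1)] that unfolding Lambda by blast
    have "hausdorff_measure (seq_dist F) s {} = 0" for s
      using hausdorff_measure_null_finite_covers[of "{}" "seq_dist F" s]
      by (metis (no_types, lifting) empty_iff empty_subsetI finite.emptyI card.empty mult_zero_left of_nat_0 order_less_imp_le)
    then have "hausdorff_dim (seq_dist F) (Lambda F) = ereal 0"
      unfolding empty by (intro hausdorff_dim_eqI) auto
    then show ?thesis by (simp add: zero_ereal_def)
  qed
  ultimately show ?thesis by blast
qed

end
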